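(* For every $V > 0$, $\omega \in \mathbb{T}$, and $p > 0$, we have $$\beta_{\delta_0}^\pm(p) \ge \frac{\log \frac{\sqrt{5} + 1}{2}}{\log \frac{\sqrt{5} + 1}{2} + \log [(5 + 2V)^{1/2} (3 + V) a_V]} - \frac{3 \log [(5 + 2V)^{1/2} (3 + V) a_V]}{p\left( \log \frac{\sqrt{5} + 1}{2} + \log [(5 + 2V)^{1/2} (3 + V) a_V] \right)},$$ where the time-average is given by $\langle f \rangle(T) = \frac{2}{T} \int_0^\infty e^{-2t/T} f(t)\,dt$.
   Context: Let $\alpha = \frac{\sqrt{5}-1}{2}$. For $V>0$ and $\omega \in \mathbb{T} = \mathbb{R}/\mathbb{Z}$, the Fibonacci Hamiltonian is the bounded self-adjoint operator on $\ell^2(\mathbb{Z})$ given by $$[H_{V,\omega} \psi](n) = \psi(n+1) + \psi(n-1) + V \chi_{[1-\alpha,1)}(n\alpha + \omega \bmod 1)\, \psi(n).$$ $a_V$ denotes the largest root of the polynomial $x^3-(2+V)x-1$, and $\{\delta_n\}_{n\in\mathbb{Z}}$ is the standard basis of $\ell^2(\mathbb{Z})$. Transport exponents: for $\psi\in\ell^2(\mathbb{Z})$ and $p>0$ put $$\langle |X|_\psi^p\rangle(t) = \sum_{n\in\mathbb{Z}} |n|^p\, |\langle \delta_n, e^{-itH_{V,\omega}}\psi\rangle|^2 ,$$ let $\langle\langle |X|_\psi^p\rangle\rangle(T)$ denote the time average $\langle f\rangle(T)$ of $f(t)=\langle |X|_\psi^p\rangle(t)$, and define $$\beta_\psi^+(p)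 = \limsup_{T\to\infty} \frac{\log \langle\langle |X|_\psi^p\rangle\rangle(T)}{p\log T}, \qquad \beta_\psi^-(p) = \liminf_{T\to\infty} \frac{\log \langle\langle |X|_\psi^p\rangle\rangle(T)}{p\log T}.$$ The inequality is asserted for both $\beta^+_{\delta_0}$ and $\beta^-_{\delta_0}$. *)

theory Defs
  imports "HOL-Analysis.Analysis"
begin

section \<open>The Hilbert space of square-summable two-sided sequences\<close>

definition square_summable :: "(int \<Rightarrow> complex) \<Rightarrow> bool" where
  "square_summable f \<longleftrightarrow> (\<lambda>n. (cmod (f n))\<^sup>2) summable_on UNIV"

lemma square_summable_bounded:
  assumes "\<And>F. finite F \<Longrightarrow> (\<Sum>n\<in>F. (cmod (f n))\<^sup>2) \<le> B"
  shows "square_summable f"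
  unfolding square_summable_def
  by (rule nonneg_bdd_above_summable_on) (auto intro!: bdd_aboveI2[where M = B] assms)

lemma square_summable_zero: "square_summable (\<lambda>n. 0)"
  by (simp add: square_summable_def)

lemma square_summable_add:
  assumes "square_summable f" "square_summable g"
  shows "square_summable (\<lambda>n. f n + g n)"
  unfolding square_summable_def
proof (rule summable_on_comparison_test)
  show "(\<lambda>n. 2 * (cmod (f n))\<^sup>2 + 2 * (cmod (g n))\<^sup>2) summable_on UNIV"
    using assms unfolding square_summable_def
    by (intro summable_on_add summable_on_cmult_right)
next
  fix n
  have "(cmod (f n + g n))\<^sup>2 \<le> (cmod (f n) + cmod (g n))\<^sup>2"
    by (intro power_mono norm_triangle_ineq) auto
  also have "\<dots> \<le> 2 * (cmod (f n))\<^sup>2 + 2 * (cmod (g n))\<^sup>2"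
    using zero_le_power2[of "cmod (f n) - cmod (g n)"]
    by (simp add: power2_eq_square algebra_simps)
  finally show "(cmod (f n + g n))\<^sup>2 \<le> 2 * (cmod (f n))\<^sup>2 + 2 * (cmod (g n))\<^sup>2" .
qed auto

lemma square_summable_mult_bounded:
  assumes "square_summable f" and "\<And>n. cmod (c n) \<le> B"
  shows "square_summable (\<lambda>n. c n * f n)"
  unfolding square_summable_def
proof (rule summable_on_comparison_test)
  show "(\<lambda>n. B\<^sup>2 * (cmod (f n))\<^sup>2) summable_on UNIV"
    using assms(1) unfolding square_summable_def by (rule summable_on_cmult_right)
next
  fix n
  have "(cmod (c n))\<^sup>2 \<le> B\<^sup>2"
    using assms(2) by (intro power_mono) auto
  then show "(cmod (c n * f n))\<^sup>2 \<le> B\<^sup>2 * (cmod (f n))\<^sup>2"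
    by (simp add: norm_mult power_mult_distrib mult_right_mono)
qed auto

lemma square_summable_cmult:
  "square_summable f \<Longrightarrow> square_summable (\<lambda>n. c * f n)"
  by (rule square_summable_mult_bounded[where B = "cmod c"]) auto

lemma square_summable_shift:
  assumes "square_summable f"
  shows "square_summable (\<lambda>n. f (n + k))"
proof -
  have "bij (\<lambda>n::int. n + k)"
    by (rule bij_betwI[where g = "\<lambda>n. n - k"]) auto
  from summable_on_reindex_bij_betw[OF this, of "\<lambda>n. (cmod (f n))\<^sup>2"]
  show ?thesis using assms by (simp add: square_summable_def)
qed

lemma square_summable_product:
  assumes "square_summable f" "square_summable g"
  shows "(\<lambda>n. cnj (f n) * g n) summable_on UNIV"
proof (rule abs_summable_summable, rule abs_summable_product)
  show "(\<lambda>n. cmod (cnj (f n) * cnj (f n))) summable_on UNIV"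
    "(\<lambda>n. cmod (g n * g n)) summable_on UNIV"
    using assms by (simp_all add: square_summable_def norm_mult power2_eq_square)
qed

typedef ell2 = "{f :: int \<Rightarrow> complex. square_summable f}"
  morphisms coord Abs_ell2
  using square_summable_zero by auto

setup_lifting type_definition_ell2

lemma square_summable_coord [simp]: "square_summable (coord \<psi>)"
  using coord by auto

lemma ell2_eqI: "(\<And>n. coord \<phi> n = coord \<psi> n) \<Longrightarrow> \<phi> = \<psi>"
  by transfer auto

instantiation ell2 :: real_vector
begin

lift_definition zero_ell2 :: ell2 is "\<lambda>n. 0"
  by (rule square_summable_zero)

lift_definition plus_ell2 :: "ell2 \<Rightarrow> ell2 \<Rightarrow> ell2" is "\<lambda>f g n. f n + g n"
  by (rule square_summable_add)

lift_definition uminus_ell2 :: "ell2 \<Rightarrow> ell2" is "\<lambda>f n. - f n"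
  by (simp add: square_summable_def)

lift_definition minus_ell2 :: "ell2 \<Rightarrow> ell2 \<Rightarrow> ell2" is "\<lambda>f g n. f n - g n"
  using square_summable_add[of _ "\<lambda>n. - _ n"] by (simp add: square_summable_def)

lift_definition scaleR_ell2 :: "real \<Rightarrow> ell2 \<Rightarrow> ell2" is "\<lambda>r f n. r *\<^sub>R f n"
  using square_summable_cmult by (simp add: scaleR_conv_of_real)

instance
  by standard (transfer; simp add: algebra_simps)+

end

lemma coord_zero [simp]: "coord 0 n = 0"
  by transfer simp

lemma coord_add [simp]: "coord (\<phi> + \<psi>) n = coord \<phi> n + coord \<psi> n"
  by transfer simp

lemma coord_diff [simp]: "coord (\<phi> - \<psi>) n = coord \<phi> n - coord \<psi> n"
  by transfer simp

lemma coord_scaleR [simp]: "coord (r *\<^sub>R \<psi>) n = r *\<^sub>R coord \<psi> n"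
  by transfer simp

definition cinner_ell2 :: "ell2 \<Rightarrow> ell2 \<Rightarrow> complex" where
  "cinner_ell2 \<phi> \<psi> = (\<Sum>\<^sub>\<infinity>n. cnj (coord \<phi> n) * coord \<psi> n)"

lemma summable_cinner_ell2: "(\<lambda>n. cnj (coord \<phi> n) * coord \<psi> n) summable_on UNIV"
  by (rule square_summable_product) auto

lemma Re_cinner_ell2_self: "Re (cinner_ell2 \<psi> \<psi>) = (\<Sum>\<^sub>\<infinity>n. (cmod (coord \<psi> n))\<^sup>2)"
  unfolding cinner_ell2_def infsum_Re[OF summable_cinner_ell2, symmetric]
  by (intro infsum_cong) (simp add: cmod_power2 flip: power2_eq_square)

instantiation ell2 :: real_inner
begin

definition inner_ell2 :: "ell2 \<Rightarrow> ell2 \<Rightarrow> real" where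
  "inner_ell2 \<phi> \<psi> = Re (cinner_ell2 \<phi> \<psi>)"

definition norm_ell2 :: "ell2 \<Rightarrow> real" where
  "norm_ell2 \<psi> = sqrt (inner \<psi> \<psi>)"

definition sgn_ell2 :: "ell2 \<Rightarrow> ell2" where
  "sgn_ell2 \<psi> = \<psi> /\<^sub>R norm \<psi>"

definition dist_ell2 :: "ell2 \<Rightarrow> ell2 \<Rightarrow> real" where
  "dist_ell2 \<phi> \<psi> = norm (\<phi> - \<psi>)"

definition [code del]:
  "(uniformity :: (ell2 \<times> ell2) filter) = (INF e\<in>{0<..}. principal {(x, y). dist x y < e})"

definition open_ell2 :: "ell2 set \<Rightarrow> bool" where [code del]:
  "open_ell2 S \<longleftrightarrow> (\<forall>x\<in>S. \<forall>\<^sub>F (x', y) in uniformity. x' = x \<longrightarrow> y \<in> S)"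

instance
proof
  fix \<phi> \<psi> \<xi> :: ell2 and r :: real
  note Re_infsum = infsum_Re[OF summable_cinner_ell2, symmetric]
  show "inner \<phi> \<psi> = inner \<psi> \<phi>"
    unfolding inner_ell2_def cinner_ell2_def Re_infsum
    by (intro infsum_cong) (simp add: algebra_simps)
  show "inner (\<phi> + \<psi>) \<xi> = inner \<phi> \<xi> + inner \<psi> \<xi>"
    unfolding inner_ell2_def cinner_ell2_def
    by (simp add: ring_distribs infsum_add summable_cinner_ell2)
  show "inner (r *\<^sub>R \<phi>) \<psi> = r * inner \<phi> \<psi>"
    unfolding inner_ell2_def cinner_ell2_def
    by (simp add: scaleR_conv_of_real mult.assoc infsum_cmult_right')
  show "0 \<le> inner \<phi> \<phi>"
    unfolding inner_ell2_def Re_cinner_ell2_self by (intro infsum_nonneg) auto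
  show "inner \<phi> \<phi> = 0 \<longleftrightarrow> \<phi> = 0"
  proof
    assume "inner \<phi> \<phi> = 0"
    then have *: "(\<Sum>\<^sub>\<infinity>n. (cmod (coord \<phi> n))\<^sup>2) = 0"
      by (simp add: inner_ell2_def Re_cinner_ell2_self)
    have "(cmod (coord \<phi> n))\<^sup>2 = 0" for n
      by (rule nonneg_infsum_le_0D[of _ UNIV])
        (use * square_summable_coord[of \<phi>] in \<open>auto simp: square_summable_def\<close>)
    then show "\<phi> = 0" by (intro ell2_eqI) simp
  qed (simp add: inner_ell2_def cinner_ell2_def)
qed (simp_all add: norm_ell2_def sgn_ell2_def dist_ell2_def uniformity_ell2_def open_ell2_def)

end

lemma norm_ell2_power2: "(norm \<psi>)\<^sup>2 = (\<Sum>\<^sub>\<infinity>n. (cmod (coord \<psi> n))\<^sup>2)"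
  unfolding power2_norm_eq_inner inner_ell2_def Re_cinner_ell2_self ..

lemma sum_coord_le_norm_ell2:
  "finite F \<Longrightarrow> (\<Sum>n\<in>F. (cmod (coord \<psi> n))\<^sup>2) \<le> (norm \<psi>)\<^sup>2"
  unfolding norm_ell2_power2
  using square_summable_coord[of \<psi>]
  by (intro finite_sum_le_infsum) (auto simp: square_summable_def)

lemma norm_ell2_le:
  assumes "0 \<le> B" and "\<And>F. finite F \<Longrightarrow> (\<Sum>n\<in>F. (cmod (coord \<psi> n))\<^sup>2) \<le> B\<^sup>2"
  shows "norm \<psi> \<le> B"
proof (rule power2_le_imp_le)
  show "(norm \<psi>)\<^sup>2 \<le> B\<^sup>2"
    unfolding norm_ell2_power2
    using square_summable_coord[of \<psi>] assms(2)
    by (intro infsum_le_finite_sums) (auto simp: square_summable_def)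
qed (fact assms(1))

lemma cmod_coord_le_norm: "cmod (coord \<psi> n) \<le> norm \<psi>"
  by (rule power2_le_imp_le) (use sum_coord_le_norm_ell2[of "{n}" \<psi>] in auto)

instance ell2 :: banach
proof
  fix X :: "nat \<Rightarrow> ell2"
  assume X: "Cauchy X"
  have "Cauchy (\<lambda>i. coord (X i) n)" for n
  proof (rule metric_CauchyI)
    fix e :: real assume "e > 0"
    then obtain M where M: "\<forall>i\<ge>M. \<forall>j\<ge>M. dist (X i) (X j) < e"
      using X by (meson metric_CauchyD)
    have "dist (coord (X i) n) (coord (X j) n) \<le> dist (X i) (X j)" for i j
      using cmod_coord_le_norm[of "X i - X j" n] by (simp add: dist_norm)
    with M show "\<exists>M. \<forall>i\<ge>M. \<forall>j\<ge>M. dist (coord (X i) n) (coord (X j) n) < e"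
      by (meson le_less_trans)
  qed
  then have "\<exists>l. (\<lambda>i. coord (X i) n) \<longlonglongrightarrow> l" for n
    using Cauchy_convergent convergent_def by blast
  then obtain L where L: "\<And>n. (\<lambda>i. coord (X i) n) \<longlonglongrightarrow> L n" by metis
  have bound: "\<exists>M. \<forall>i\<ge>M. \<forall>F. finite F \<longrightarrow> (\<Sum>n\<in>F. (cmod (coord (X i) n - L n))\<^sup>2) \<le> e\<^sup>2"
    if "e > 0" for e :: real
  proof -
    obtain M where M: "\<And>i j. i \<ge> M \<Longrightarrow> j \<ge> M \<Longrightarrow> dist (X i) (X j) < e"
      using X \<open>e > 0\<close> by (meson metric_CauchyD)
    have "(\<Sum>n\<in>F. (cmod (coord (X i) n - L n))\<^sup>2) \<le> e\<^sup>2" if "i \<ge> M" "finite F" for i F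
    proof (rule tendsto_upperbound)
      show "(\<lambda>j. \<Sum>n\<in>F. (cmod (coord (X i) n - coord (X j) n))\<^sup>2)
              \<longlonglongrightarrow> (\<Sum>n\<in>F. (cmod (coord (X i) n - L n))\<^sup>2)"
        by (intro tendsto_intros L)
      have "(\<Sum>n\<in>F. (cmod (coord (X i) n - coord (X j) n))\<^sup>2) \<le> e\<^sup>2" if "j \<ge> M" for j
      proof -
        have "(\<Sum>n\<in>F. (cmod (coord (X i - X j) n))\<^sup>2) \<le> (norm (X i - X j))\<^sup>2"
          by (rule sum_coord_le_norm_ell2) fact
        also have "\<dots> \<le> e\<^sup>2"
          using M[OF \<open>i \<ge> M\<close> \<open>j \<ge> M\<close>] by (intro power_mono) (auto simp: dist_norm)
        finally show ?thesis by simp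
      qed
      then show "\<forall>\<^sub>F j in sequentially. (\<Sum>n\<in>F. (cmod (coord (X i) n - coord (X j) n))\<^sup>2) \<le> e\<^sup>2"
        by (auto simp: eventually_sequentially)
    qed simp
    then show ?thesis by blast
  qed
  obtain M where M: "\<And>F. finite F \<Longrightarrow> (\<Sum>n\<in>F. (cmod (coord (X M) n - L n))\<^sup>2) \<le> 1\<^sup>2"
    using bound[of 1] by auto
  have d: "square_summable (\<lambda>n. coord (X M) n - L n)"
    by (rule square_summable_bounded[OF M])
  have "square_summable (\<lambda>n. coord (X M) n + (- 1) * (coord (X M) n - L n))"
    by (intro square_summable_add square_summable_cmult square_summable_coord d)
  then have "square_summable L" by simp
  then have L': "coord (Abs_ell2 L) = L"
    by (simp add: Abs_ell2_inverse)
  have "X \<longlonglongrightarrow> Abs_ell2 L"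
  proof (rule metric_LIMSEQ_I)
    fix e :: real assume "e > 0"
    then obtain M where
      M: "\<forall>i\<ge>M. \<forall>F. finite F \<longrightarrow> (\<Sum>n\<in>F. (cmod (coord (X i) n - L n))\<^sup>2) \<le> (e / 2)\<^sup>2"
      using bound[of "e / 2"] by auto
    have "norm (X i - Abs_ell2 L) \<le> e / 2" if "i \<ge> M" for i
      by (rule norm_ell2_le) (use M that \<open>e > 0\<close> L' in auto)
    then have "norm (X i - Abs_ell2 L) < e" if "i \<ge> M" for i
      by (rule le_less_trans) (use that \<open>e > 0\<close> in auto)
    then show "\<exists>M. \<forall>i\<ge>M. dist (X i) (Abs_ell2 L) < e"
      unfolding dist_norm by blast
  qed
  then show "convergent X" by (auto simp: convergent_def)
qed

lift_definition basis_ell2 :: "int \<Rightarrow> ell2" is "\<lambda>m n. if n = m then 1 else 0"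
proof -
  fix m :: int
  show "square_summable (\<lambda>n. if n = m then 1 else 0)"
    unfolding square_summable_def
    by (rule summable_on_cong_neutral[where S = "{m}", THEN iffD1, OF _ _ _ summable_on_finite])
      auto
qed

lemma cinner_basis_ell2: "cinner_ell2 (basis_ell2 n) \<psi> = coord \<psi> n"
proof -
  have "cinner_ell2 (basis_ell2 n) \<psi> = (\<Sum>\<^sub>\<infinity>k\<in>{n}. coord \<psi> k)"
    unfolding cinner_ell2_def by (rule infsum_cong_neutral) (auto simp: basis_ell2.rep_eq)
  then show ?thesis by simp
qed


section \<open>Bounded operators and their exponential\<close>

text \<open>Bounded operators are bounded real-linear maps; multiplication by a complex scalar
  is itself one of them.\<close>

lift_definition scale_ell2 :: "complex \<Rightarrow> ell2 \<Rightarrow> ell2" is "\<lambda>c f n. c * f n"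
  by (rule square_summable_cmult)

lemma coord_scale_ell2 [simp]: "coord (scale_ell2 c \<psi>) n = c * coord \<psi> n"
  by transfer simp

lemma bounded_linear_scale_ell2: "bounded_linear (scale_ell2 c)"
proof (rule bounded_linear_intro[where K = "cmod c"])
  fix \<psi>
  have "(\<Sum>n\<in>F. (cmod (coord (scale_ell2 c \<psi>) n))\<^sup>2) \<le> (norm \<psi> * cmod c)\<^sup>2" if "finite F" for F
    using mult_left_mono[OF sum_coord_le_norm_ell2[OF that, of \<psi>], of "(cmod c)\<^sup>2"]
    by (simp add: norm_mult power_mult_distrib sum_distrib_left mult.commute[of _ "(cmod c)\<^sup>2"])
  then show "norm (scale_ell2 c \<psi>) \<le> norm \<psi> * cmod c"
    by (intro norm_ell2_le) auto
qed (auto intro!: ell2_eqI simp: algebra_simps)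

lift_definition scalar_op :: "complex \<Rightarrow> ell2 \<Rightarrow>\<^sub>L ell2" is scale_ell2
  by (rule bounded_linear_scale_ell2)

definition blinfun_exp :: "'a::real_normed_vector \<Rightarrow>\<^sub>L 'a \<Rightarrow> 'a \<Rightarrow>\<^sub>L 'a" where
  "blinfun_exp A = (\<Sum>k. (((o\<^sub>L) A ^^ k) id_blinfun) /\<^sub>R fact k)"

lemma summable_blinfun_exp:
  fixes A :: "'a::banach \<Rightarrow>\<^sub>L 'a"
  shows "summable (\<lambda>k. (((o\<^sub>L) A ^^ k) id_blinfun) /\<^sub>R fact k)"
proof (rule summable_comparison_test')
  show "summable (\<lambda>k. norm (id_blinfun :: 'a \<Rightarrow>\<^sub>L 'a) * (norm A ^ k /\<^sub>R fact k))"
    by (intro summable_mult summable_exp_generic)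
next
  fix k
  have "norm (((o\<^sub>L) A ^^ k) id_blinfun) \<le> norm (id_blinfun :: 'a \<Rightarrow>\<^sub>L 'a) * norm A ^ k"
  proof (induction k)
    case (Suc k)
    have "norm (((o\<^sub>L) A ^^ Suc k) id_blinfun) \<le> norm A * norm (((o\<^sub>L) A ^^ k) id_blinfun)"
      by (simp add: norm_blinfun_compose)
    also have "\<dots> \<le> norm A * (norm (id_blinfun :: 'a \<Rightarrow>\<^sub>L 'a) * norm A ^ k)"
      by (intro mult_left_mono Suc.IH) auto
    finally show ?case by (simp add: mult_ac)
  qed simp
  then show "norm ((((o\<^sub>L) A ^^ k) id_blinfun) /\<^sub>R fact k)
      \<le> norm (id_blinfun :: 'a \<Rightarrow>\<^sub>L 'a) * (norm A ^ k /\<^sub>R fact k)"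
    by (simp add: divide_right_mono divide_inverse mult.commute[of "inverse _"] mult.assoc[symmetric])
qed

definition unitary_group :: "(ell2 \<Rightarrow>\<^sub>L ell2) \<Rightarrow> real \<Rightarrow> ell2 \<Rightarrow>\<^sub>L ell2" where
  "unitary_group H t = blinfun_exp (scalar_op (- \<i> * of_real t) o\<^sub>L H)"


section \<open>The Fibonacci Hamiltonian\<close>

definition golden_alpha :: real where
  "golden_alpha = (sqrt 5 - 1) / 2"

text \<open>A point of the circle is given by any real representative \<open>\<omega>\<close>; the potential depends on it
  only modulo 1.\<close>

definition fib_potential :: "real \<Rightarrow> real \<Rightarrow> int \<Rightarrow> real" where
  "fib_potential V \<omega> n =
     V * indicator {1 - golden_alpha..<1} (frac (of_int n * golden_alpha + \<omega>))"

lemma fib_potential_periodic: "fib_potential V (\<omega> + of_int k) = fib_potential V \<omega>"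
  unfolding fib_potential_def by (simp add: frac_def add.assoc[symmetric] fun_eq_iff)

lemma abs_fib_potential_le: "\<bar>fib_potential V \<omega> n\<bar> \<le> \<bar>V\<bar>"
  by (simp add: fib_potential_def indicator_def)

lift_definition fib_map :: "real \<Rightarrow> real \<Rightarrow> ell2 \<Rightarrow> ell2" is
  "\<lambda>V \<omega> \<psi> n. \<psi> (n + 1) + \<psi> (n - 1) + of_real (fib_potential V \<omega> n) * \<psi> n"
proof -
  fix V \<omega> :: real and \<psi> :: "int \<Rightarrow> complex"
  assume \<psi>: "square_summable \<psi>"
  show "square_summable
    (\<lambda>n. \<psi> (n + 1) + \<psi> (n - 1) + of_real (fib_potential V \<omega> n) * \<psi> n)"
    using square_summable_shift[OF \<psi>, of 1] square_summable_shift[OF \<psi>, of "-1"]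
    by (intro square_summable_add square_summable_mult_bounded[OF \<psi>, where B = "\<bar>V\<bar>"])
      (auto simp: abs_fib_potential_le)
qed

lift_definition shift_ell2 :: "int \<Rightarrow> ell2 \<Rightarrow> ell2" is "\<lambda>k \<psi> n. \<psi> (n + k)"
  by (rule square_summable_shift)

lemma norm_shift_ell2: "norm (shift_ell2 k \<psi>) = norm \<psi>"
proof -
  have "bij (\<lambda>n::int. n + k)"
    by (rule bij_betwI[where g = "\<lambda>n. n - k"]) auto
  from infsum_reindex_bij_betw[OF this, of "\<lambda>n. (cmod (coord \<psi> n))\<^sup>2"]
  have "(norm (shift_ell2 k \<psi>))\<^sup>2 = (norm \<psi>)\<^sup>2"
    by (simp add: norm_ell2_power2 shift_ell2.rep_eq)
  then show ?thesis by simp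
qed

lemma bounded_linear_fib_map: "bounded_linear (fib_map V \<omega>)"
proof (rule bounded_linear_intro[where K = "2 + \<bar>V\<bar>"])
  fix \<psi>
  define \<xi> where "\<xi> = fib_map V \<omega> \<psi> - (shift_ell2 1 \<psi> + shift_ell2 (- 1) \<psi>)"
  have \<xi>: "coord \<xi> n = of_real (fib_potential V \<omega> n) * coord \<psi> n" for n
    by (simp add: \<xi>_def fib_map.rep_eq shift_ell2.rep_eq)
  have "norm \<xi> \<le> \<bar>V\<bar> * norm \<psi>"
  proof (rule norm_ell2_le)
    fix F :: "int set" assume F: "finite F"
    have "(cmod (coord \<xi> n))\<^sup>2 \<le> \<bar>V\<bar>\<^sup>2 * (cmod (coord \<psi> n))\<^sup>2" for n
      unfolding \<xi> norm_mult power_mult_distrib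
      by (intro mult_right_mono power_mono) (auto simp: abs_fib_potential_le)
    then have "(\<Sum>n\<in>F. (cmod (coord \<xi> n))\<^sup>2) \<le> \<bar>V\<bar>\<^sup>2 * (\<Sum>n\<in>F. (cmod (coord \<psi> n))\<^sup>2)"
      unfolding sum_distrib_left by (rule sum_mono)
    also have "\<dots> \<le> \<bar>V\<bar>\<^sup>2 * (norm \<psi>)\<^sup>2"
      by (intro mult_left_mono sum_coord_le_norm_ell2 F) auto
    finally show "(\<Sum>n\<in>F. (cmod (coord \<xi> n))\<^sup>2) \<le> (\<bar>V\<bar> * norm \<psi>)\<^sup>2"
      by (simp add: power_mult_distrib)
  qed auto
  moreover have "norm (fib_map V \<omega> \<psi>) \<le> norm (shift_ell2 1 \<psi>) + norm (shift_ell2 (- 1) \<psi>) + norm \<xi>"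
  proof -
    have "fib_map V \<omega> \<psi> = shift_ell2 1 \<psi> + shift_ell2 (- 1) \<psi> + \<xi>"
      by (simp add: \<xi>_def)
    then show ?thesis
      by (metis norm_triangle_le norm_triangle_ineq add_right_mono)
  qed
  ultimately show "norm (fib_map V \<omega> \<psi>) \<le> norm \<psi> * (2 + \<bar>V\<bar>)"
    by (simp add: norm_shift_ell2 algebra_simps)
qed (auto intro!: ell2_eqI simp: fib_map.rep_eq algebra_simps)

lift_definition fibonacci_hamiltonian :: "real \<Rightarrow> real \<Rightarrow> ell2 \<Rightarrow>\<^sub>L ell2" is fib_map
  by (rule bounded_linear_fib_map)

lemma fibonacci_hamiltonian_apply:
  "coord (fibonacci_hamiltonian V \<omega> \<psi>) n =
     coord \<psi> (n + 1) + coord \<psi> (n - 1)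
       + of_real (V * indicator {1 - golden_alpha..<1} (frac (of_int n * golden_alpha + \<omega>)))
         * coord \<psi> n"
  by (simp add: fibonacci_hamiltonian.rep_eq fib_map.rep_eq fib_potential_def)

lemma fibonacci_hamiltonian_selfadjoint:
  "cinner_ell2 \<phi> (fibonacci_hamiltonian V \<omega> \<psi>) = cinner_ell2 (fibonacci_hamiltonian V \<omega> \<phi>) \<psi>"
proof -
  define s where "s k \<phi> \<psi> = (\<Sum>\<^sub>\<infinity>n::int. cnj (coord \<phi> n) * coord \<psi> (n + k))" for k \<phi> \<psi>
  define v where "v n = complex_of_real (fib_potential V \<omega> n)" for n
  have sum_shift: "(\<lambda>n. cnj (coord \<phi> n) * coord \<psi> (n + k)) summable_on UNIV" for k \<phi> \<psi>
    by (intro square_summable_product square_summable_shift square_summable_coord)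
  have sum_v: "(\<lambda>n. v n * (cnj (coord \<phi> n) * coord \<psi> n)) summable_on UNIV" for \<phi> \<psi>
    using square_summable_product[OF square_summable_coord
        square_summable_mult_bounded[OF square_summable_coord, of v "\<bar>V\<bar>"], of \<phi> \<psi>]
    by (simp add: v_def abs_fib_potential_le mult_ac)
  have right: "cinner_ell2 \<phi> (fibonacci_hamiltonian V \<omega> \<psi>)
      = s 1 \<phi> \<psi> + s (- 1) \<phi> \<psi> + (\<Sum>\<^sub>\<infinity>n. v n * (cnj (coord \<phi> n) * coord \<psi> n))" for \<phi> \<psi>
  proof -
    have "cinner_ell2 \<phi> (fibonacci_hamiltonian V \<omega> \<psi>)
        = (\<Sum>\<^sub>\<infinity>n. (cnj (coord \<phi> n) * coord \<psi> (n + 1) + cnj (coord \<phi> n) * coord \<psi> (n + - 1))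
            + v n * (cnj (coord \<phi> n) * coord \<psi> n))"
      unfolding cinner_ell2_def
      by (intro infsum_cong)
        (simp add: fibonacci_hamiltonian.rep_eq fib_map.rep_eq v_def algebra_simps)
    then show ?thesis
      unfolding s_def by (simp only: infsum_add sum_shift sum_v summable_on_add)
  qed
  have swap: "cnj (s k \<psi> \<phi>) = s (- k) \<phi> \<psi>" for k
  proof -
    have "bij (\<lambda>n::int. n + k)"
      by (rule bij_betwI[where g = "\<lambda>n. n - k"]) auto
    from infsum_reindex_bij_betw[OF this, of "\<lambda>n. cnj (coord \<phi> n) * coord \<psi> (n + - k)"]
    show ?thesis by (simp add: s_def infsum_cnj[symmetric] mult.commute)
  qed
  have "cinner_ell2 (fibonacci_hamiltonian V \<omega> \<phi>) \<psi>
      = cnj (cinner_ell2 \<psi> (fibonacci_hamiltonian V \<omega> \<phi>))"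
    unfolding cinner_ell2_def by (simp add: infsum_cnj[symmetric] mult.commute)
  also have "\<dots> = s (- 1) \<phi> \<psi> + s 1 \<phi> \<psi> + (\<Sum>\<^sub>\<infinity>n. v n * (cnj (coord \<phi> n) * coord \<psi> n))"
    unfolding right by (simp add: swap infsum_cnj[symmetric] v_def mult_ac)
  finally show ?thesis unfolding right by simp
qed

definition a_root :: "real \<Rightarrow> real" where
  "a_root V = Max {x::real. x ^ 3 - (2 + V) * x - 1 = 0}"


section \<open>Transport exponents\<close>

text \<open>Moments and their averages may be infinite for a general \<open>\<psi>\<close>, so they are taken in
  \<^typ>\<open>ennreal\<close> and the exponents in \<^typ>\<open>ereal\<close>.\<close>

definition position_moment ::
    "(ell2 \<Rightarrow>\<^sub>L ell2) \<Rightarrow> ell2 \<Rightarrow> real \<Rightarrow> real \<Rightarrow> ennreal" where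
  "position_moment H \<psi> p t =
     (\<Sum>\<^sub>\<infinity>n. ennreal (\<bar>real_of_int n\<bar> powr p
        * (cmod (cinner_ell2 (basis_ell2 n) (unitary_group H t \<psi>)))\<^sup>2))"

definition time_average :: "(real \<Rightarrow> ennreal) \<Rightarrow> real \<Rightarrow> ennreal" where
  "time_average f T = ennreal (2 / T) * (\<integral>\<^sup>+t\<in>{0..}. ennreal (exp (- 2 * t / T)) * f t \<partial>lborel)"

definition ln_ennreal :: "ennreal \<Rightarrow> ereal" where
  "ln_ennreal x = (if x = 0 then - \<infinity> else if x = \<infinity> then \<infinity> else ereal (ln (enn2real x)))"

definition growth_rate ::
    "(ell2 \<Rightarrow>\<^sub>L ell2) \<Rightarrow> ell2 \<Rightarrow> real \<Rightarrow> real \<Rightarrow> ereal" where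
  "growth_rate H \<psi> p T = ln_ennreal (time_average (position_moment H \<psi> p) T) / ereal (p * ln T)"

definition upper_transport_exponent ::
    "(ell2 \<Rightarrow>\<^sub>L ell2) \<Rightarrow> ell2 \<Rightarrow> real \<Rightarrow> ereal" where
  "upper_transport_exponent H \<psi> p = Limsup at_top (growth_rate H \<psi> p)"

definition lower_transport_exponent ::
    "(ell2 \<Rightarrow>\<^sub>L ell2) \<Rightarrow> ell2 \<Rightarrow> real \<Rightarrow> ereal" where
  "lower_transport_exponent H \<psi> p = Liminf at_top (growth_rate H \<psi> p)"

end

theory Submission
  imports Defs "HOL-Number_Theory.Fib" "HOL-Number_Theory.Cong" "HOL-Real_Asymp.Real_Asymp"
begin

text \<open>Let \<open>z = E + 2 \<i> / T\<close>. The Laplace transform of \<open>exp (- \<i> t H) \<delta>\<^sub>0\<close> solves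
  \<open>(H - z) u = \<delta>\<^sub>0\<close>, and by Cauchy-Schwarz the time average of \<open>\<bar>\<langle>\<delta>\<^sub>n, exp (- \<i> t H) \<delta>\<^sub>0\<rangle>\<bar>\<^sup>2\<close> is at
  least \<open>(4 / T\<^sup>2) \<bar>u n\<bar>\<^sup>2\<close>. So it suffices to find one energy \<open>E\<close> and one site far away
  from 0 at which \<open>u\<close> is not small.

  For every phase, among any four consecutive Fibonacci numbers there is one, say \<open>q\<close>, such that the
  potential to the right of 0 (or, by reflection, to the left) starts with a square of period \<open>q\<close>.
  By Cayley-Hamilton (Gordon's argument) \<open>u (2 q) = x u q - u 0\<close>, where \<open>x\<close> is the trace of the
  transfer matrix over one period. This trace depends neither on the phase nor on the position: the word
  is a mechanical word of rational slope, hence a cyclic shift of the Fibonacci word of length \<open>q\<close>.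
  If \<open>x\<close> is bounded, \<open>u\<close> is bounded below at distance at least \<open>q\<close> from 0.

  The traces obey the trace map. At a real energy where some late trace vanishes, no two consecutive
  earlier traces exceed 2 in modulus, for otherwise the orbit escapes; the Fricke-Vogt invariant then bounds
  them by \<open>6 + V\<close>. An error \<open>2 / T\<close> in the energy grows at most like \<open>(8 + V) ^ j\<close>, so the bound
  persists at \<open>z\<close> up to \<open>j = ln (T / 2) / ln (8 + V)\<close>. This gives the exponent
  \<open>\<phi> / ln (8 + V) - 2 / p\<close>, which is better than the claimed one.\<close>

section \<open>Squares in the coding of the golden rotation\<close>

lemma golden_alpha_pos: "0 < golden_alpha"
  by (simp add: golden_alpha_def)

lemma golden_alpha_less_1: "golden_alpha < 1"
proof -
  have "sqrt 5 < sqrt 9" by (subst real_sqrt_less_iff) simp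
  then show ?thesis by (simp add: golden_alpha_def)
qed

lemma golden_alpha_square: "golden_alpha ^ 2 = 1 - golden_alpha"
  by (simp add: golden_alpha_def power2_eq_square field_simps)

section \<open>Approximation of the golden rotation by Fibonacci numbers\<close>

definition fib_err :: "nat \<Rightarrow> real" where
  "fib_err k = (-1) ^ k * golden_alpha ^ Suc k"

text \<open>Both sides obey the Fibonacci recursion because
  \<open>golden_alpha ^ 2 = 1 - golden_alpha\<close>. The alternating sign later separates even and
  odd levels.\<close>

lemma fib_err_eq: "real (fib (Suc k)) * golden_alpha - real (fib k) = fib_err k"
proof (induction k rule: fib.induct)
  case (3 n)
  have "fib_err (Suc (Suc n)) = fib_err n * golden_alpha\<^sup>2"
    by (simp add: fib_err_def power2_eq_square)
  also have "\<dots> = fib_err n + fib_err (Suc n)"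
    unfolding golden_alpha_square by (simp add: fib_err_def algebra_simps)
  finally show ?case using 3 by (simp add: algebra_simps)
qed (use golden_alpha_square in \<open>auto simp: fib_err_def power2_eq_square\<close>)

text \<open>The two vectors of consecutive Fibonacci numbers form a basis of the integer lattice.
  Passing to the next level is the unimodular change from \<open>(s, t)\<close> to
  \<open>(t - s, s)\<close>.\<close>

lemma fib_coordinates:
  fixes N M :: int
  shows "\<exists>s t. N = s * int (fib (Suc k)) + t * int (fib (Suc (Suc k))) \<and>
               M = s * int (fib k) + t * int (fib (Suc k))"
proof (induction k)
  case 0
  show ?case by (rule exI[of _ "N - M"], rule exI[of _ M]) simp
next
  case (Suc k)
  then obtain s t where "N = s * int (fib (Suc k)) + t * int (fib (Suc (Suc k)))"
    "M = s * int (fib k) + t * int (fib (Suc k))" by blast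
  then show ?case
    by (intro exI[of _ "t - s"] exI[of _ s]) (simp add: algebra_simps)
qed

text \<open>Errors of consecutive levels have opposite signs; the factor \<open>(-1) ^ k\<close>
  normalises them. An integer and its distance from resonance become two linear forms in the same
  \<open>s\<close> and \<open>t\<close>.\<close>

lemma fib_coordinates_err:
  fixes N M :: int
  obtains s t :: int where "N = s * int (fib (Suc k)) + t * int (fib (Suc (Suc k)))"
    "(-1) ^ k * (of_int N * golden_alpha - of_int M)
       = of_int s * golden_alpha ^ Suc k - of_int t * golden_alpha ^ Suc (Suc k)"
proof -
  obtain s t where st: "N = s * int (fib (Suc k)) + t * int (fib (Suc (Suc k)))"
    "M = s * int (fib k) + t * int (fib (Suc k))"
    using fib_coordinates by blast
  have "of_int N * golden_alpha - of_int M
      = of_int s * (real (fib (Suc k)) * golden_alpha - real (fib k))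
        + of_int t * (real (fib (Suc (Suc k))) * golden_alpha - real (fib (Suc k)))"
    unfolding st by (simp add: algebra_simps)
  also have "\<dots> = of_int s * fib_err k + of_int t * fib_err (Suc k)"
    by (simp only: fib_err_eq)
  finally have "(-1) ^ k * (of_int N * golden_alpha - of_int M)
     = of_int s * ((-1) ^ k * fib_err k) + of_int t * ((-1) ^ k * fib_err (Suc k))"
    by (simp add: algebra_simps)
  also have "\<dots> = of_int s * golden_alpha ^ Suc k - of_int t * golden_alpha ^ Suc (Suc k)"
    by (simp add: fib_err_def flip: power_add power_mult_distrib mult_2 mult.assoc)
  finally show ?thesis using st(1) that by blast
qed

lemma golden_power_Suc_less: "golden_alpha ^ Suc k < golden_alpha ^ k"
  using golden_alpha_pos golden_alpha_less_1 by (simp add: power_less_imp_less_exp)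

text \<open>The two linear forms conflict: for \<open>s \<ge> 1\<close>, a positive \<open>t\<close>
  makes \<open>s * q + t * r\<close> too large and a negative \<open>t\<close> makes
  \<open>s * d - t * e\<close> too large. For \<open>s \<le> 0\<close>, positivity forces
  \<open>t \<le> -1\<close>, and the integer form drops below \<open>- q\<close>.\<close>

lemma int_coordinates_unique:
  fixes s t q r :: int and d e :: real
  assumes "0 < e" "e < d" "0 < q" "q < r"
    and "0 < of_int s * d - of_int t * e" "of_int s * d - of_int t * e < d + e"
    and "- q \<le> s * q + t * r" "s * q + t * r \<le> r"
  shows "s = 1 \<and> t = 0"
proof (cases "s \<ge> 1")
  case True
  have sq: "s * q \<ge> q" and sd: "of_int s * d \<ge> d" using True assms by auto
  have "\<not> t \<ge> 1"
  proof
    assume "t \<ge> 1"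
    then have "t * r \<ge> 1 * r" using assms by (intro mult_right_mono) auto
    then show False using sq assms by linarith
  qed
  moreover have "\<not> t \<le> -1"
  proof
    assume "t \<le> -1"
    then have "of_int t \<le> (-1 :: real)" by linarith
    then have "of_int t * e \<le> -1 * e" using assms(1) by (intro mult_right_mono) auto
    then show False using sd assms by linarith
  qed
  ultimately have t: "t = 0" by linarith
  have "\<not> s \<ge> 2"
  proof
    assume "s \<ge> 2"
    then have "of_int s \<ge> (2 :: real)" by linarith
    then have "of_int s * d \<ge> 2 * d" using assms by (intro mult_right_mono) auto
    moreover have "of_int t * e = 0" using t by simp
    ultimately show False using assms by linarith
  qed
  with t True show ?thesis by simp
next
  case False
  then have "s \<le> 0" by simp
  then have sq: "s * q \<le> 0" and sd: "of_int s * d \<le> 0"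
    using assms by (auto simp: mult_le_0_iff)
  have "t \<le> -1"
  proof (rule ccontr)
    assume "\<not> t \<le> -1"
    then have "0 \<le> t" by simp
    then have "0 \<le> of_int t * e" using assms by simp
    then show False using sd assms by linarith
  qed
  then have "t * r \<le> -1 * r" using assms by (intro mult_right_mono) auto
  then show ?thesis using sq assms by linarith
qed

text \<open>Either sign of \<open>s\<close> forces \<open>t \<ge> 1\<close>. Then
  \<open>s \<ge> 1\<close> makes the integer form exceed \<open>r\<close>, while
  \<open>s \<le> -1\<close> pushes the real form below \<open>- d\<close>.\<close>

lemma int_coordinates_none:
  fixes s t q r :: int and d e :: real
  assumes "0 < e" "0 < d" "0 < q" "0 < r"
    and "- d \<le> of_int s * d - of_int t * e" "of_int s * d - of_int t * e \<le> 0"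
    and "1 \<le> s * q + t * r" "s * q + t * r < r"
  shows False
proof (cases "s \<ge> 1")
  case True
  have sq: "s * q \<ge> q" and sd: "of_int s * d \<ge> d" using True assms by auto
  have "t \<ge> 1"
  proof (rule ccontr)
    assume "\<not> t \<ge> 1"
    then have "of_int t * e \<le> 0" using assms by (simp add: mult_le_0_iff)
    then show False using sd assms by linarith
  qed
  then have "t * r \<ge> 1 * r" using assms by (intro mult_right_mono) auto
  then show False using sq assms by linarith
next
  case False
  then have sq: "s * q \<le> 0" using assms by (auto simp: mult_le_0_iff)
  have "t \<ge> 1"
  proof (rule ccontr)
    assume "\<not> t \<ge> 1"
    then have "t * r \<le> 0" using assms by (simp add: mult_le_0_iff)
    then show False using sq assms by linarith
  qed
  then have tr: "t * r \<ge> 1 * r" and te: "of_int t * e \<ge> 1 * e"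
    using assms by (auto intro!: mult_right_mono)
  have "s \<noteq> 0"
  proof
    assume "s = 0"
    then have "s * q = 0" by simp
    then show False using tr assms by linarith
  qed
  with False have "of_int s \<le> (-1 :: real)" by linarith
  then have "of_int s * d \<le> -1 * d" using assms by (intro mult_right_mono) auto
  then show False using te assms by linarith
qed

lemma floor_add_neqE:
  fixes y \<delta> :: real
  assumes "\<lfloor>y + \<delta>\<rfloor> \<noteq> \<lfloor>y\<rfloor>"
  obtains m :: int where "0 < \<delta> \<Longrightarrow> y < of_int m \<and> of_int m \<le> y + \<delta>"
    "\<delta> < 0 \<Longrightarrow> y + \<delta> < of_int m \<and> of_int m \<le> y"
proof (cases "\<delta> > 0")
  case True
  then have "\<lfloor>y\<rfloor> \<le> \<lfloor>y + \<delta>\<rfloor>" by (intro floor_mono) auto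
  with assms have "\<lfloor>y\<rfloor> < \<lfloor>y + \<delta>\<rfloor>" by simp
  then have "y < of_int \<lfloor>y + \<delta>\<rfloor>" by (simp add: floor_less_iff)
  with True that[of "\<lfloor>y + \<delta>\<rfloor>"] show ?thesis by simp
next
  case False
  then have "\<lfloor>y + \<delta>\<rfloor> \<le> \<lfloor>y\<rfloor>" by (intro floor_mono) auto
  with assms have "\<lfloor>y + \<delta>\<rfloor> < \<lfloor>y\<rfloor>" by simp
  then have "y + \<delta> < of_int \<lfloor>y\<rfloor>" by (simp add: floor_less_iff)
  with False that[of "\<lfloor>y\<rfloor>"] show ?thesis by simp
qed

text \<open>The sign of \<open>fib_err k\<close> decides on which side of the crossed integer
  \<open>m\<close> the point lies. The half-open ends later yield strict inequalities.\<close>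

lemma floor_add_fib_err_neqE:
  assumes "\<lfloor>y + fib_err k\<rfloor> \<noteq> \<lfloor>y\<rfloor>"
  obtains m :: int where
    "even k \<Longrightarrow> - (golden_alpha ^ Suc k) \<le> y - of_int m \<and> y - of_int m < 0"
    "odd k \<Longrightarrow> 0 \<le> y - of_int m \<and> y - of_int m < golden_alpha ^ Suc k"
proof -
  have pos: "golden_alpha ^ Suc k > 0" using golden_alpha_pos by simp
  have "even k \<Longrightarrow> fib_err k = golden_alpha ^ Suc k" "odd k \<Longrightarrow> fib_err k = - (golden_alpha ^ Suc k)"
    by (auto simp: fib_err_def)
  then show ?thesis
    using floor_add_neqE[OF assms] pos that
    by (smt (verit, best))
qed

text \<open>The differences of the two points and of the two crossed integers are expanded in the
  lattice basis of level \<open>k\<close>. The size of the errors and the index ranges leave only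
  the basis vector \<open>s = 1\<close>, \<open>t = 0\<close>.\<close>

lemma consecutive_crossings:
  fixes n n' :: int
  assumes "k \<ge> 1"
    and cross: "\<lfloor>(of_int n * golden_alpha + \<omega>) + fib_err k\<rfloor> \<noteq> \<lfloor>of_int n * golden_alpha + \<omega>\<rfloor>"
    and cross': "\<lfloor>(of_int n' * golden_alpha + \<omega>) + fib_err (Suc k)\<rfloor> \<noteq> \<lfloor>of_int n' * golden_alpha + \<omega>\<rfloor>"
    and range: "1 \<le> n" "n \<le> int (fib (Suc k)) + 1" "1 \<le> n'" "n' \<le> int (fib (Suc (Suc k))) + 1"
  shows "n' = n + int (fib (Suc k))"
proof -
  obtain m where m: "even k \<Longrightarrow> - (golden_alpha ^ Suc k) \<le> of_int n * golden_alpha + \<omega> - of_int m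
        \<and> of_int n * golden_alpha + \<omega> - of_int m < 0"
      "odd k \<Longrightarrow> 0 \<le> of_int n * golden_alpha + \<omega> - of_int m
        \<and> of_int n * golden_alpha + \<omega> - of_int m < golden_alpha ^ Suc k"
    using floor_add_fib_err_neqE[OF cross] by blast
  obtain m' where m': "even (Suc k) \<Longrightarrow> - (golden_alpha ^ Suc (Suc k)) \<le> of_int n' * golden_alpha + \<omega> - of_int m'
        \<and> of_int n' * golden_alpha + \<omega> - of_int m' < 0"
      "odd (Suc k) \<Longrightarrow> 0 \<le> of_int n' * golden_alpha + \<omega> - of_int m'
        \<and> of_int n' * golden_alpha + \<omega> - of_int m' < golden_alpha ^ Suc (Suc k)"
    using floor_add_fib_err_neqE[OF cross'] by blast
  obtain s t where st: "n' - n = s * int (fib (Suc k)) + t * int (fib (Suc (Suc k)))"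
    "(-1) ^ k * (of_int (n' - n) * golden_alpha - of_int (m' - m))
       = of_int s * golden_alpha ^ Suc k - of_int t * golden_alpha ^ Suc (Suc k)"
    using fib_coordinates_err[of "n' - n" k "m' - m"] by blast
  define D where "D = (of_int n' * golden_alpha + \<omega> - of_int m') - (of_int n * golden_alpha + \<omega> - of_int m)"
  have D: "of_int (n' - n) * golden_alpha - of_int (m' - m) = D"
    by (simp add: D_def algebra_simps)
  \<comment> \<open>The levels have opposite parity, so the points lie on opposite sides of their
    integers and the two distances add up.\<close>
  have bounds: "0 < (-1) ^ k * D \<and> (-1) ^ k * D < golden_alpha ^ Suc k + golden_alpha ^ Suc (Suc k)"
  proof (cases "even k")
    case True
    then show ?thesis using m(1)[OF True] m'(2) unfolding D_def by simp
  next
    case False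
    then have "even (Suc k)" by simp
    show ?thesis using m(2)[OF False] m'(1)[OF \<open>even (Suc k)\<close>] False unfolding D_def by simp
  qed
  have fibpos: "0 < fib k" using assms(1) by (simp add: fib_neq_0_nat)
  have "s = 1 \<and> t = 0"
  proof (rule int_coordinates_unique)
    show "golden_alpha ^ Suc (Suc k) < golden_alpha ^ Suc k" by (rule golden_power_Suc_less)
    show "0 < golden_alpha ^ Suc (Suc k)" using golden_alpha_pos by simp
    show "0 < int (fib (Suc k))" by (simp add: fib_neq_0_nat)
    show "int (fib (Suc k)) < int (fib (Suc (Suc k)))" using fibpos by simp
  qed (use bounds st range D in auto)
  with st(1) show ?thesis by simp
qed

text \<open>This is the best approximation property of Fibonacci denominators: at phase
  \<open>0\<close> the point \<open>n\<close> itself is expanded in the lattice basis, and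
  \<open>int_coordinates_none\<close> excludes a crossing.\<close>

lemma floor_mult_golden_add_fib_err:
  fixes n :: int
  assumes "1 \<le> n" "n < int (fib (Suc (Suc k)))"
  shows "\<lfloor>of_int n * golden_alpha + fib_err k\<rfloor> = \<lfloor>of_int n * golden_alpha\<rfloor>"
proof (rule ccontr)
  assume "\<lfloor>of_int n * golden_alpha + fib_err k\<rfloor> \<noteq> \<lfloor>of_int n * golden_alpha\<rfloor>"
  then obtain m where m: "even k \<Longrightarrow> - (golden_alpha ^ Suc k) \<le> of_int n * golden_alpha - of_int m
        \<and> of_int n * golden_alpha - of_int m < 0"
      "odd k \<Longrightarrow> 0 \<le> of_int n * golden_alpha - of_int m
        \<and> of_int n * golden_alpha - of_int m < golden_alpha ^ Suc k"
    using floor_add_fib_err_neqE by blast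
  obtain s t where st: "n = s * int (fib (Suc k)) + t * int (fib (Suc (Suc k)))"
    "(-1) ^ k * (of_int n * golden_alpha - of_int m)
       = of_int s * golden_alpha ^ Suc k - of_int t * golden_alpha ^ Suc (Suc k)"
    using fib_coordinates_err[of n k m] by blast
  have bounds: "- (golden_alpha ^ Suc k) \<le> (-1) ^ k * (of_int n * golden_alpha - of_int m) \<and>
     (-1) ^ k * (of_int n * golden_alpha - of_int m) \<le> 0"
  proof (cases "even k")
    case True
    then show ?thesis using m(1)[OF True] by simp
  next
    case False
    then show ?thesis using m(2)[OF False] by simp
  qed
  show False
    by (rule int_coordinates_none[of "golden_alpha ^ Suc (Suc k)" "golden_alpha ^ Suc k"
          "int (fib (Suc k))" "int (fib (Suc (Suc k)))" s t])
      (use bounds st assms golden_alpha_pos in \<open>auto simp: fib_neq_0_nat add_pos_nonneg\<close>)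
qed

text \<open>Translation by the period \<open>q = fib (Suc k)\<close> moves the rotation by \<open>fib_err k\<close> modulo 1. If no point
  \<open>1, \<dots>, q + 1\<close> crosses an integer, the coding starts with a square of period \<open>q\<close> at site 1.\<close>

definition fib_square :: "real \<Rightarrow> nat \<Rightarrow> bool" where
  "fib_square \<omega> k \<longleftrightarrow> (\<forall>n::int. 1 \<le> n \<and> n \<le> int (fib (Suc k)) + 1 \<longrightarrow>
     \<lfloor>of_int n * golden_alpha + \<omega> + fib_err k\<rfloor> = \<lfloor>of_int n * golden_alpha + \<omega>\<rfloor>)"

text \<open>From \<open>k \<ge> 3\<close> comes \<open>fib k \<ge> 2\<close>, so that
  \<open>fib (Suc k) + 1\<close> is still below \<open>fib (Suc (Suc k))\<close>.\<close>

lemma fib_square_zero: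
  assumes "k \<ge> 3"
  shows "fib_square 0 k"
proof -
  have "fib 3 \<le> fib k" using assms by (rule fib_mono)
  then have "fib k \<ge> 2" by (simp add: numeral_3_eq_3)
  then show ?thesis
    unfolding fib_square_def using floor_mult_golden_add_fib_err[of _ k] by auto
qed

text \<open>If four consecutive levels fail at points \<open>c k, \<dots>, c (k + 3)\<close>, consecutive ones differ by the period,
  so \<open>c (k + 3) = c (k + 1) + fib (k + 4)\<close> forces \<open>c (k + 1) = 1\<close>, whereas \<open>c (k + 1) > c k \<ge> 1\<close>.\<close>

lemma fib_square_exists:
  assumes "k \<ge> 1"
  shows "\<exists>j\<in>{k..k+3}. fib_square \<omega> j"
proof (rule ccontr)
  assume none: "\<not> (\<exists>j\<in>{k..k+3}. fib_square \<omega> j)"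
  have "\<exists>n::int. 1 \<le> n \<and> n \<le> int (fib (Suc j)) + 1 \<and>
     \<lfloor>of_int n * golden_alpha + \<omega> + fib_err j\<rfloor> \<noteq> \<lfloor>of_int n * golden_alpha + \<omega>\<rfloor>"
    if "j \<in> {k..k+3}" for j
    using none that unfolding fib_square_def by blast
  then obtain c where c: "\<And>j. j \<in> {k..k+3} \<Longrightarrow> 1 \<le> c j \<and> c j \<le> int (fib (Suc j)) + 1 \<and>
     \<lfloor>of_int (c j) * golden_alpha + \<omega> + fib_err j\<rfloor> \<noteq> \<lfloor>of_int (c j) * golden_alpha + \<omega>\<rfloor>"
    by metis
  have step: "c (Suc j) = c j + int (fib (Suc j))" if "j \<in> {k..k+2}" for j
    by (rule consecutive_crossings[where \<omega> = \<omega>]) (use c[of j] c[of "Suc j"] that assms in auto)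
  have "c (Suc k) = c k + int (fib (Suc k))" "c (Suc (Suc k)) = c (Suc k) + int (fib (Suc (Suc k)))"
    "c (Suc (Suc (Suc k))) = c (Suc (Suc k)) + int (fib (Suc (Suc (Suc k))))"
    using step[of k] step[of "Suc k"] step[of "Suc (Suc k)"] by auto
  moreover have "c k \<ge> 1" "c (Suc (Suc (Suc k))) \<le> int (fib (Suc (Suc (Suc (Suc k))))) + 1"
    using c[of k] c[of "Suc (Suc (Suc k))"] by auto
  moreover have "fib (Suc k) > 0" by (simp add: fib_neq_0_nat)
  ultimately show False by simp
qed

section \<open>Transfer matrices and the trace map\<close>

text \<open>With \<open>e\<close> the energy minus the potential at \<open>n\<close>, this sends the
  column \<open>(w n, w (n - 1))\<close> of a solution to \<open>(w (n + 1), w n)\<close>.\<close>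

definition step_mat :: "complex \<Rightarrow> complex^2^2" where
  "step_mat e = vector [vector [e, -1], vector [1, 0]]"

text \<open>The product covers the sites \<open>m + 1, ..., m + n\<close>, with later sites on the
  left.\<close>

primrec word_mat :: "(int \<Rightarrow> complex) \<Rightarrow> int \<Rightarrow> nat \<Rightarrow> complex^2^2" where
  "word_mat f m 0 = mat 1"
| "word_mat f m (Suc n) = step_mat (f (m + int n + 1)) ** word_mat f m n"

lemma word_mat_add: "word_mat f m (n + k) = word_mat f (m + int n) k ** word_mat f m n"
  by (induction k) (simp_all add: matrix_mul_assoc add.assoc)

lemma word_mat_Suc_left: "word_mat f m (Suc n) = word_mat f (m + 1) n ** step_mat (f (m + 1))"
  using word_mat_add[of f m 1 n] by simp

lemma word_mat_cong:
  assumes "\<And>i. 1 \<le> i \<Longrightarrow> i \<le> int n \<Longrightarrow> f (m + i) = g (l + i)"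
  shows "word_mat f m n = word_mat g l n"
  using assms
proof (induction n)
  case (Suc n)
  then have "f (m + (int n + 1)) = g (l + (int n + 1))" by (intro Suc.prems) auto
  then have "f (m + int n + 1) = g (l + int n + 1)" by (simp add: add.assoc)
  moreover have "word_mat f m n = word_mat g l n" by (rule Suc.IH) (use Suc.prems in auto)
  ultimately show ?case by simp
qed simp

lemma det_step_mat: "det (step_mat e) = 1"
  by (simp add: det_2 step_mat_def)

lemma det_word_mat: "det (word_mat f m n) = 1"
  by (induction n) (simp_all add: det_mul det_step_mat)

lemma trace_2: "trace (A :: 'a::comm_ring_1^2^2) = A$1$1 + A$2$2"
  by (simp add: trace_def sum_2)

lemma cayley_hamilton_2:
  fixes M :: "complex^2^2" and x :: "complex^2"
  assumes "det M = 1"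
  shows "M *v (M *v x) = trace M *s (M *v x) - x"
proof -
  have d: "M$1$1 * M$2$2 = 1 + M$1$2 * M$2$1"
    using assms by (simp add: det_2 algebra_simps)
  have "M$1$1 * M$2$2 * x$1 = (1 + M$1$2 * M$2$1) * x$1" "M$1$1 * M$2$2 * x$2 = (1 + M$1$2 * M$2$1) * x$2"
    unfolding d by auto
  then show ?thesis
    by (simp add: vec_eq_iff forall_2 matrix_vector_mult_def sum_2 trace_2 algebra_simps)
qed

text \<open>Cayley-Hamilton for \<open>M\<close>, multiplied by \<open>N\<close>, together with
  cyclicity of the trace. This identity produces the trace map.\<close>

lemma trace_square_mul:
  fixes M N :: "complex^2^2"
  assumes "det M = 1"
  shows "trace (M ** (N ** M)) = trace M * trace (N ** M) - trace N"
proof -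
  have d: "M$1$1 * M$2$2 = 1 + M$1$2 * M$2$1"
    using assms by (simp add: det_2 algebra_simps)
  have "M$1$1 * M$2$2 * N$1$1 = (1 + M$1$2 * M$2$1) * N$1$1"
    "M$1$1 * M$2$2 * N$2$2 = (1 + M$1$2 * M$2$1) * N$2$2"
    unfolding d by auto
  then show ?thesis
    by (simp add: trace_2 matrix_matrix_mult_def sum_2 algebra_simps)
qed

text \<open>Moving the window by one site carries one factor from the right end of the product to
  the left end, and the trace is cyclic.\<close>

lemma trace_word_mat_shift:
  assumes "q \<ge> 1" and "\<And>n. f (n + int q) = f n"
  shows "trace (word_mat f (m + 1) q) = trace (word_mat f m q)"
proof -
  obtain r where r: "q = Suc r" using assms(1) by (cases q) auto
  have "f (m + 1 + int r + 1) = f (m + 1)"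
    using assms(2)[of "m + 1"] unfolding r by (simp add: algebra_simps)
  then have "word_mat f (m + 1) q = step_mat (f (m + 1)) ** word_mat f (m + 1) r"
    by (simp add: r)
  moreover have "word_mat f m q = word_mat f (m + 1) r ** step_mat (f (m + 1))"
    unfolding r by (rule word_mat_Suc_left)
  ultimately show ?thesis by (simp only: trace_mul_sym[of "word_mat f (m + 1) r"])
qed

lemma trace_word_mat_shifts:
  assumes "q \<ge> 1" and "\<And>n. f (n + int q) = f n"
  shows "trace (word_mat f (int m) q) = trace (word_mat f 0 q)"
proof (induction m)
  case (Suc m)
  have "trace (word_mat f (int m + 1) q) = trace (word_mat f (int m) q)"
    using assms by (intro trace_word_mat_shift)
  then show ?case using Suc by (simp add: add.commute)
qed simp

section \<open>Mechanical words and independence of the trace from the phase\<close>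

definition fib_word :: "real \<Rightarrow> int \<Rightarrow> int" where
  "fib_word \<omega> n = \<lfloor>of_int (n + 1) * golden_alpha + \<omega>\<rfloor> - \<lfloor>of_int n * golden_alpha + \<omega>\<rfloor>"

text \<open>The rotated point lies in \<open>[1 - golden_alpha, 1)\<close> modulo 1 exactly when
  adding \<open>golden_alpha\<close> carries it past an integer.\<close>

lemma fib_potential_eq: "fib_potential V \<omega> n = V * of_int (fib_word \<omega> n)"
proof -
  define y where "y = of_int n * golden_alpha + \<omega>"
  have f: "\<lfloor>y\<rfloor> \<le> y" "y < \<lfloor>y\<rfloor> + 1" by linarith+
  have "\<lfloor>y + golden_alpha\<rfloor> - \<lfloor>y\<rfloor> = (if frac y \<ge> 1 - golden_alpha then 1 else 0)"
    using golden_alpha_pos golden_alpha_less_1 f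
    by (auto simp: frac_def intro!: floor_unique; linarith)
  moreover have "of_int (n + 1) * golden_alpha + \<omega> = y + golden_alpha"
    by (simp add: y_def algebra_simps)
  ultimately have "fib_word \<omega> n = (if frac y \<ge> 1 - golden_alpha then 1 else 0)"
    by (simp only: fib_word_def y_def)
  then show ?thesis
    unfolding fib_potential_def using frac_lt_1[of y]
    by (auto simp: y_def indicator_def)
qed

text \<open>The same coding for the rational rotation number \<open>p / q\<close> and the phase
  \<open>l / q\<close>, with floors written as integer division.\<close>

definition mechanical_word :: "int \<Rightarrow> int \<Rightarrow> int \<Rightarrow> int \<Rightarrow> int" where
  "mechanical_word p q l n = ((n + 1) * p + l) div q - (n * p + l) div q"

lemma mechanical_word_periodic:
  assumes "q \<noteq> 0"
  shows "mechanical_word p q l (n + q) = mechanical_word p q l n"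
proof -
  have "((n + q) + 1) * p + l = ((n + 1) * p + l) + p * q" "(n + q) * p + l = (n * p + l) + p * q"
    by (simp_all add: algebra_simps)
  then show ?thesis using assms by (simp only: mechanical_word_def div_mult_self1) simp
qed

lemma mechanical_word_shift: "mechanical_word p q (l + m * p) n = mechanical_word p q l (n + m)"
  by (simp add: mechanical_word_def algebra_simps)

lemma mechanical_word_phase:
  assumes "q \<noteq> 0"
  shows "mechanical_word p q (l + m * q) n = mechanical_word p q l n"
proof -
  have "(n + 1) * p + (l + m * q) = ((n + 1) * p + l) + m * q" "n * p + (l + m * q) = (n * p + l) + m * q"
    by (simp_all add: algebra_simps)
  then show ?thesis using assms by (simp only: mechanical_word_def div_mult_self1) simp
qed

text \<open>As \<open>p\<close> is invertible modulo \<open>q\<close>, some \<open>m\<close>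
  satisfies \<open>m * p = l' - l\<close> modulo \<open>q\<close>. A change of phase is therefore a
  shift by \<open>m\<close> sites, which the trace over a period does not see.\<close>

lemma trace_mechanical_word:
  fixes p :: int and q :: nat
  assumes "q \<ge> 1" "coprime p (int q)"
  shows "trace (word_mat (\<lambda>n. g (mechanical_word p (int q) l n)) 0 q)
       = trace (word_mat (\<lambda>n. g (mechanical_word p (int q) l' n)) 0 q)"
proof -
  have q: "int q \<noteq> 0" using assms by simp
  obtain b where b: "[p * b = l' - l] (mod int q)"
    using assms(2) cong_solve_dvd_int[of p "int q" ] cong_solve_coprime_int[of p "int q"]
    by (metis cong_scalar_right mult.assoc mult_1)
  define m where "m = nat (b mod int q)"
  have m: "int m = b mod int q" using assms by (simp add: m_def)
  have "[int m * p = l' - l] (mod int q)"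
    unfolding m using b by (metis cong_def mod_mult_left_eq mult.commute)
  then obtain k where k: "l' - l = int m * p + k * int q"
    by (metis cong_iff_lin cong_sym mult.commute)
  have "mechanical_word p (int q) l' n = mechanical_word p (int q) l (n + int m)" for n
  proof -
    have "l' = (l + int m * p) + k * int q" using k by simp
    then show ?thesis using mechanical_word_phase[OF q] mechanical_word_shift by metis
  qed
  then have "word_mat (\<lambda>n. g (mechanical_word p (int q) l' n)) 0 q
      = word_mat (\<lambda>n. g (mechanical_word p (int q) l n)) (int m) q"
    by (intro word_mat_cong) (simp add: add.commute)
  then show ?thesis
    using trace_word_mat_shifts[of q "\<lambda>n. g (mechanical_word p (int q) l n)" m] assms
    by (simp add: mechanical_word_periodic)
qed

text \<open>On a square the rotation number may be replaced by its convergent \<open>p / q\<close>: shift the phase by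
  \<open>(q + 1) \<delta> / q\<close>, which lies between the drift \<open>n \<delta> / q\<close> and \<open>n \<delta> / q + \<delta>\<close> whenever
  \<open>1 \<le> n \<le> q + 1\<close>.\<close>

lemma fib_square_mechanical:
  assumes "fib_square \<omega> k"
  obtains l where "\<And>n. 1 \<le> n \<Longrightarrow> n \<le> int (fib (Suc k)) \<Longrightarrow>
     fib_word \<omega> n = mechanical_word (int (fib k)) (int (fib (Suc k))) l n"
proof -
  define p q \<delta> where "p = int (fib k)" and "q = int (fib (Suc k))" and "\<delta> = fib_err k"
  have q: "q > 0" by (simp add: q_def fib_neq_0_nat)
  have \<delta>: "of_int q * golden_alpha - of_int p = \<delta>"
    using fib_err_eq[of k] by (simp add: p_def q_def \<delta>_def)
  then have \<alpha>: "golden_alpha = (of_int p + \<delta>) / of_int q" using q by (simp add: field_simps)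
  define c where "c = \<omega> + (of_int q + 1) * \<delta> / of_int q"
  define l where "l = \<lfloor>of_int q * c\<rfloor>"
  have floor_eq: "\<lfloor>of_int n * golden_alpha + \<omega>\<rfloor> = (n * p + l) div q" if "1 \<le> n" "n \<le> q + 1" for n
  proof -
    define y where "y = of_int n * golden_alpha + \<omega>"
    define y' where "y' = of_int n * of_int p / of_int q + c"
    have sq: "\<lfloor>y + \<delta>\<rfloor> = \<lfloor>y\<rfloor>"
      using assms that unfolding fib_square_def y_def \<delta>_def q_def by auto
    have "y' - y = (of_int q + 1 - of_int n) * (\<delta> / of_int q)"
      unfolding y'_def y_def c_def \<alpha> using q by (simp add: field_simps)
    then have diff: "y' - y = ((of_int q + 1 - of_int n) / of_int q) * \<delta>" by simp
    define r where "r = (of_int q + 1 - of_int n) / (of_int q :: real)"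
    have r: "0 \<le> r" "r \<le> 1"
      using that q by (auto simp: r_def field_simps)
    have y': "y' = y + r * \<delta>" using diff by (simp add: r_def)
    have "\<lfloor>y'\<rfloor> = \<lfloor>y\<rfloor>"
    proof (cases "\<delta> \<ge> 0")
      case True
      then have "y \<le> y'" "y' \<le> y + \<delta>" unfolding y' using r by (auto simp: mult_left_le_one_le)
      then show ?thesis using sq by (metis floor_mono order_antisym)
    next
      case False
      then have "r * \<delta> \<le> 0" "\<delta> \<le> r * \<delta>" using r mult_right_mono_neg[of r 1 \<delta>]
        by (auto simp: mult_le_0_iff)
      then have "y' \<le> y" "y + \<delta> \<le> y'" unfolding y' by auto
      then show ?thesis using sq by (metis floor_mono order_antisym)
    qed
    moreover have "\<lfloor>y'\<rfloor> = (n * p + l) div q"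
    proof -
      have "y' = (of_int (n * p) + of_int q * c) / of_int q" using q by (simp add: y'_def field_simps)
      then have "\<lfloor>y'\<rfloor> = \<lfloor>of_int (n * p) + of_int q * c\<rfloor> div q"
        using q floor_divide_real_eq_div[of q "of_int (n * p) + of_int q * c"] by simp
      then show ?thesis by (simp add: l_def floor_add_int[symmetric] del: of_int_mult)
    qed
    ultimately show ?thesis by (simp add: y_def)
  qed
  have "fib_word \<omega> n = mechanical_word p q l n" if "1 \<le> n" "n \<le> q" for n
    unfolding fib_word_def mechanical_word_def using floor_eq[of n] floor_eq[of "n + 1"] that by simp
  then show ?thesis using that unfolding p_def q_def by blast
qed

lemma trace_fib_square:
  assumes "fib_square \<omega> k" "fib_square \<omega>' k"
  shows "trace (word_mat (\<lambda>n. g (fib_word \<omega> n)) 0 (fib (Suc k)))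
       = trace (word_mat (\<lambda>n. g (fib_word \<omega>' n)) 0 (fib (Suc k)))"
proof -
  have rational: "\<exists>l. word_mat (\<lambda>n. g (fib_word \<omega> n)) 0 (fib (Suc k))
      = word_mat (\<lambda>n. g (mechanical_word (int (fib k)) (int (fib (Suc k))) l n)) 0 (fib (Suc k))"
    if sq: "fib_square \<omega> k" for \<omega>
  proof -
    from fib_square_mechanical[OF sq] obtain l where "\<And>n. 1 \<le> n \<Longrightarrow> n \<le> int (fib (Suc k)) \<Longrightarrow>
     fib_word \<omega> n = mechanical_word (int (fib k)) (int (fib (Suc k))) l n" by blast
    then show ?thesis by (intro exI[of _ l] word_mat_cong) auto
  qed
  have "coprime (int (fib k)) (int (fib (Suc k)))" "fib (Suc k) \<ge> 1"
    using coprime_fib_Suc_nat[of k] by (auto simp: Suc_le_eq fib_neq_0_nat)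
  then show ?thesis
    using rational[OF assms(1)] rational[OF assms(2)] trace_mechanical_word by metis
qed

text \<open>The letter at \<open>n\<close> involves the floors at \<open>n\<close> and
  \<open>n + 1\<close>; hence the range up to \<open>fib (Suc k) + 1\<close> in
  \<open>fib_square\<close>.\<close>

lemma fib_word_square:
  assumes "fib_square \<omega> k" "1 \<le> n" "n \<le> int (fib (Suc k))"
  shows "fib_word \<omega> (n + int (fib (Suc k))) = fib_word \<omega> n"
proof -
  have shift: "\<lfloor>of_int (n + int (fib (Suc k))) * golden_alpha + \<omega>\<rfloor>
      = \<lfloor>of_int n * golden_alpha + \<omega>\<rfloor> + int (fib k)" if "1 \<le> n" "n \<le> int (fib (Suc k)) + 1" for n :: int
  proof -
    have "of_int (n + int (fib (Suc k))) * golden_alpha + \<omega>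
        = (of_int n * golden_alpha + \<omega> + fib_err k) + of_int (int (fib k))"
      unfolding fib_err_eq[symmetric] by (simp add: algebra_simps)
    then show ?thesis
      using assms(1) that unfolding fib_square_def by (simp only: floor_add_int[symmetric])
  qed
  have e: "n + int (fib (Suc k)) + 1 = (n + 1) + int (fib (Suc k))" by simp
  show ?thesis
    using shift[of n] shift[of "n + 1"] assms(2,3) unfolding fib_word_def e by (simp del: of_int_add)
qed

text \<open>The entry \<open>n \<ge> 1\<close> is the trace over a word of length \<open>fib n\<close>; the entry \<open>0\<close> continues the trace
  map one step backwards, where there is no word.\<close>

fun fib_trace :: "'a::comm_ring_1 \<Rightarrow> 'a \<Rightarrow> nat \<Rightarrow> 'a" where
  "fib_trace V z 0 = 2"
| "fib_trace V z (Suc 0) = z"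
| "fib_trace V z (Suc (Suc 0)) = z - V"
| "fib_trace V z (Suc (Suc (Suc n)))
     = fib_trace V z (Suc (Suc n)) * fib_trace V z (Suc n) - fib_trace V z n"

text \<open>Source of the concatenation rule at phase \<open>0\<close>: a prefix of Fibonacci length
  is the preceding one followed by the one before that.\<close>

lemma fib_word_zero_periodic:
  assumes "1 \<le> k" "1 \<le> n" "n \<le> int (fib (Suc k))"
  shows "fib_word 0 (n + int (fib (Suc (Suc k)))) = fib_word 0 n"
proof -
  have pos: "fib k > 0" "fib (Suc k) > 0" using assms(1) by (simp_all add: fib_neq_0_nat)
  have shift: "\<lfloor>of_int (n + int (fib (Suc (Suc k)))) * golden_alpha\<rfloor>
      = \<lfloor>of_int n * golden_alpha\<rfloor> + int (fib (Suc k))" if "1 \<le> n" "n \<le> int (fib (Suc k)) + 1" for n :: int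
  proof -
    have "of_int (n + int (fib (Suc (Suc k)))) * golden_alpha
        = (of_int n * golden_alpha + fib_err (Suc k)) + of_int (int (fib (Suc k)))"
      unfolding fib_err_eq[symmetric] by (simp add: algebra_simps)
    moreover have "n < int (fib (Suc (Suc (Suc k))))"
      using that pos by simp
    ultimately show ?thesis
      using that floor_mult_golden_add_fib_err[of n "Suc k"] by (simp only: floor_add_int[symmetric])
  qed
  have e: "n + int (fib (Suc (Suc k))) + 1 = (n + 1) + int (fib (Suc (Suc k)))" by simp
  show ?thesis
    using shift[of n] shift[of "n + 1"] assms(2,3) unfolding fib_word_def e
    by (simp del: of_int_add fib.simps)
qed

text \<open>The first matrix belongs to the letter 0, which is not a prefix of the word \<open>10110\<dots>\<close>; it only
  starts the recursion.\<close>

fun fib_mat :: "complex \<Rightarrow> complex \<Rightarrow> nat \<Rightarrow> complex^2^2" where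
  "fib_mat V z 0 = step_mat z"
| "fib_mat V z (Suc 0) = step_mat (z - V)"
| "fib_mat V z (Suc (Suc k)) = fib_mat V z k ** fib_mat V z (Suc k)"

lemma det_fib_mat: "det (fib_mat V z k) = 1"
  by (induction V z k rule: fib_mat.induct) (simp_all add: det_step_mat det_mul)

lemma trace_fib_mat: "trace (fib_mat V z k) = fib_trace V z (Suc k)"
proof (induction k rule: less_induct)
  case (less k)
  consider "k = 0" | "k = 1" | "k = 2" | j where "k = Suc (Suc (Suc j))"
    by (metis One_nat_def Suc_1 not0_implies_Suc)
  then show ?case
  proof cases
    \<comment> \<open>The only case in which \<open>fib_trace V z 0\<close> enters; the explicit
      product confirms the starting value \<open>2\<close>.\<close>
    case 3
    then show ?thesis
      by (simp add: numeral_2_eq_2 trace_2 step_mat_def matrix_matrix_mult_def sum_2)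
  next
    case (4 j)
    have "trace (fib_mat V z k) = trace (fib_mat V z (Suc j)) * trace (fib_mat V z (Suc (Suc j)))
        - trace (fib_mat V z j)"
      unfolding 4 using trace_square_mul[OF det_fib_mat, of V z "Suc j" "fib_mat V z j"] by simp
    then show ?thesis
      using less.IH[of j] less.IH[of "Suc j"] less.IH[of "Suc (Suc j)"] 4 by simp
  qed (simp_all add: trace_2 step_mat_def)
qed

lemma fib_word_zero_1: "fib_word 0 1 = 1" and fib_word_zero_2: "fib_word 0 2 = 0"
proof -
  have "(11 / 5)\<^sup>2 < (5::real)" "5 < (7 / 3 :: real)\<^sup>2" by (simp_all add: power2_eq_square)
  then have "11 / 5 < sqrt 5" "sqrt 5 < 7 / 3"
    using real_less_rsqrt[of "11 / 5" 5] real_less_lsqrt[of "7 / 3" 5] by auto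
  then have a: "3 / 5 < golden_alpha" "golden_alpha < 2 / 3" by (auto simp: golden_alpha_def)
  have "\<lfloor>golden_alpha\<rfloor> = 0" "\<lfloor>2 * golden_alpha\<rfloor> = 1" "\<lfloor>3 * golden_alpha\<rfloor> = 1"
    using a by (auto intro!: floor_unique)
  then show "fib_word 0 1 = 1" "fib_word 0 2 = 0" by (simp_all add: fib_word_def)
qed

text \<open>The base cases are the prefixes \<open>1\<close> and \<open>10\<close>. Afterwards the
  concatenation rule matches the recursion of \<open>fib_mat\<close>, where the later block stands
  on the left.\<close>

lemma word_mat_fib_word_zero:
  "word_mat (\<lambda>n. z - V * of_int (fib_word 0 n)) 0 (fib (Suc (Suc k))) = fib_mat V z (Suc k)"
proof (induction k rule: less_induct)
  case (less k)
  let ?f = "\<lambda>n. z - V * of_int (fib_word 0 n)"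
  consider "k = 0" | "k = 1" | j where "k = Suc (Suc j)"
    by (metis One_nat_def not0_implies_Suc)
  then show ?case
  proof cases
    case (3 j)
    have "word_mat ?f 0 (fib (Suc (Suc k)))
        = word_mat ?f (0 + int (fib (Suc (Suc (Suc j))))) (fib (Suc (Suc j))) ** word_mat ?f 0 (fib (Suc (Suc (Suc j))))"
      unfolding 3 using word_mat_add[of ?f 0 "fib (Suc (Suc (Suc j)))" "fib (Suc (Suc j))"]
      by (simp only: fib.simps)
    also have "word_mat ?f (0 + int (fib (Suc (Suc (Suc j))))) (fib (Suc (Suc j))) = word_mat ?f 0 (fib (Suc (Suc j)))"
      by (rule word_mat_cong)
        (use fib_word_zero_periodic[of "Suc j"] in \<open>simp add: add.commute del: fib.simps\<close>)
    finally show ?thesis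
      using less.IH[of j] less.IH[of "Suc j"] 3 by (simp del: fib.simps)
  next
    case 2
    then show ?thesis by (simp add: fib_word_zero_1 fib_word_zero_2)
  qed (simp add: fib_word_zero_1)
qed

text \<open>Phase \<open>0\<close> has a square at every level \<open>k \<ge> 3\<close> and so
  serves as the reference for all other phases.\<close>

lemma trace_fib_word:
  assumes "k \<ge> 3" "fib_square \<omega> k"
  shows "trace (word_mat (\<lambda>n. z - V * of_int (fib_word \<omega> n)) 0 (fib (Suc k))) = fib_trace V z (Suc k)"
proof -
  obtain j where j: "k = Suc j" using assms(1) by (cases k) auto
  show ?thesis
    using trace_fib_square[OF assms(2) fib_square_zero[OF assms(1)], of "\<lambda>c. z - V * of_int c"]
    unfolding j word_mat_fib_word_zero trace_fib_mat .
qed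

text \<open>With \<open>M\<close> the matrix over one period, the data at \<open>2 * q\<close> are
  \<open>M\<close> applied twice to the data at \<open>0\<close>, and Cayley-Hamilton applies. Both
  components are kept, since the large initial value may sit at site \<open>0\<close> or at site
  \<open>1\<close>.\<close>

lemma gordon:
  fixes w :: "int \<Rightarrow> complex"
  assumes rec: "\<And>n. 1 \<le> n \<Longrightarrow> n \<le> 2 * int q \<Longrightarrow> w (n + 1) = f n * w n - w (n - 1)"
    and per: "\<And>n. 1 \<le> n \<Longrightarrow> n \<le> int q \<Longrightarrow> f (n + int q) = f n"
  shows "w (2 * int q) = trace (word_mat f 0 q) * w (int q) - w 0"
    and "w (2 * int q + 1) = trace (word_mat f 0 q) * w (int q + 1) - w 1"
proof -
  define W where "W n = (vector [w (n + 1), w n] :: complex^2)" for n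
  have step: "W (int n + m) = word_mat f m n *v W m" if "0 \<le> m" "m + int n \<le> 2 * int q" for m n
    using that
  proof (induction n)
    case (Suc n)
    have "w (m + int n + 1 + 1) = f (m + int n + 1) * w (m + int n + 1) - w (m + int n + 1 - 1)"
      by (rule rec) (use Suc.prems in auto)
    then have "W (int (Suc n) + m) = step_mat (f (m + int n + 1)) *v W (int n + m)"
      by (simp add: W_def step_mat_def vec_eq_iff forall_2 matrix_vector_mult_def sum_2 add_ac)
    then show ?case using Suc by (simp add: matrix_vector_mul_assoc)
  qed simp
  define M where "M = word_mat f 0 q"
  have "word_mat f (int q) q = M"
    unfolding M_def by (rule word_mat_cong) (use per in \<open>simp add: add.commute\<close>)
  then have "W (2 * int q) = M *v (M *v W 0)" "W (int q) = M *v W 0"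
    using step[of "int q" q] step[of 0 q] by (simp_all add: M_def)
  then have "W (2 * int q) = trace M *s W (int q) - W 0"
    using cayley_hamilton_2[of M "W 0"] det_word_mat[of f 0 q] by (simp add: M_def)
  then show "w (2 * int q) = trace (word_mat f 0 q) * w (int q) - w 0"
    "w (2 * int q + 1) = trace (word_mat f 0 q) * w (int q + 1) - w 1"
    by (simp_all add: W_def M_def vec_eq_iff forall_2)
qed

section \<open>Escape, the invariant and stability of the trace map\<close>

lemma trace_map_escape:
  fixes x :: "nat \<Rightarrow> 'a::real_normed_field"
  assumes rec: "\<And>n. x (Suc (Suc (Suc n))) = x (Suc (Suc n)) * x (Suc n) - x n"
    and "norm (x 0) \<le> 2" "2 < norm (x 1)" "2 < norm (x 2)"
  shows "2 < norm (x (Suc i)) \<and> 2 < norm (x (Suc (Suc i))) \<and> norm (x i) \<le> norm (x (Suc (Suc i)))"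
proof (induction i)
  case 0
  then show ?case using assms by (simp add: numeral_2_eq_2)
next
  case (Suc i)
  define A B where "A = norm (x (Suc (Suc i)))" and "B = norm (x (Suc i))"
  have AB: "2 < A" "2 < B" "norm (x i) \<le> A" using Suc by (auto simp: A_def B_def)
  \<comment> \<open>The third conjunct of the induction hypothesis bounds the subtracted term by
    \<open>A\<close>, so the next modulus is at least \<open>A * (B - 1)\<close>, which exceeds
    \<open>B\<close>.\<close>
  have "B < 2 * (B - 1)" using AB by simp
  also have "\<dots> \<le> A * (B - 1)" using AB by (intro mult_right_mono) auto
  also have "\<dots> \<le> A * B - norm (x i)" using AB by (simp add: algebra_simps)
  also have "\<dots> \<le> norm (x (Suc (Suc (Suc i))))"
    unfolding rec A_def B_def norm_mult[symmetric] by (rule norm_triangle_ineq2)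
  finally show ?case using Suc AB by (simp add: A_def B_def)
qed

lemma fib_trace_escape:
  fixes V z :: "'a::real_normed_field"
  assumes "2 < norm (fib_trace V z j)" "2 < norm (fib_trace V z (Suc j))" "j < K"
  shows "2 < norm (fib_trace V z K)"
proof -
  let ?P = "\<lambda>j. 2 < norm (fib_trace V z j) \<and> 2 < norm (fib_trace V z (Suc j))"
  define l where "l = (LEAST j. ?P j)"
  have l: "?P l" "l \<le> j"
    unfolding l_def using assms LeastI[of ?P j] by (auto intro: Least_le)
  \<comment> \<open>\<open>l = 0\<close> is impossible because \<open>fib_trace V z 0 = 2\<close>.
    Minimality of \<open>l\<close> then supplies the small entry from which the escape argument
    starts.\<close>
  obtain m where m: "l = Suc m" using l by (cases l) auto
  have "\<not> ?P m" using not_less_Least[of m ?P] by (simp add: l_def[symmetric] m)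
  then have "norm (fib_trace V z m) \<le> 2" using l m by auto
  then have "2 < norm (fib_trace V z (m + Suc (K - l)))"
    using l trace_map_escape[where x = "\<lambda>i. fib_trace V z (m + i)" and i = "K - l"] by (simp add: m)
  moreover have "m + Suc (K - l) = K" using l m assms(3) by simp
  ultimately show ?thesis by simp
qed

text \<open>The polynomial is preserved by the trace map; at \<open>n = 0\<close> it reduces to
  \<open>4\<close> plus the square of \<open>z - (z - V)\<close>.\<close>

lemma fricke_vogt_invariant:
  "(fib_trace V z n)\<^sup>2 + (fib_trace V z (Suc n))\<^sup>2 + (fib_trace V z (Suc (Suc n)))\<^sup>2
     - fib_trace V z n * fib_trace V z (Suc n) * fib_trace V z (Suc (Suc n)) = 4 + V\<^sup>2"
proof (induction n)
  case 0
  then show ?case by (simp add: power2_eq_square algebra_simps)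
next
  case (Suc n)
  then show ?case by (simp add: power2_eq_square algebra_simps)
qed

text \<open>Completing the square in \<open>c\<close> expresses \<open>c - a * b / 2\<close> through
  \<open>V\<close>, \<open>4 - a ^ 2\<close> and \<open>4 - b ^ 2\<close>. Its modulus is at most
  \<open>cmod V + 4\<close>, and \<open>a * b / 2\<close> adds at most \<open>2\<close>.\<close>

lemma invariant_bound:
  fixes a b c V :: complex
  assumes "a\<^sup>2 + b\<^sup>2 + c\<^sup>2 - a * b * c = 4 + V\<^sup>2" "cmod a \<le> 2" "cmod b \<le> 2"
  shows "cmod c \<le> 6 + cmod V"
proof -
  have four: "cmod (4 - x\<^sup>2) \<le> 8" if "cmod x \<le> 2" for x
  proof -
    have "cmod (4 - x\<^sup>2) \<le> 4 + (cmod x)\<^sup>2" using norm_triangle_ineq4[of 4 "x\<^sup>2"] by (simp add: norm_power)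
    also have "(cmod x)\<^sup>2 \<le> 2\<^sup>2" using that by (intro power_mono) auto
    finally show ?thesis by simp
  qed
  have "(c - a * b / 2)\<^sup>2 = V\<^sup>2 + (4 - a\<^sup>2) * (4 - b\<^sup>2) / 4"
    using assms(1) by (simp add: power2_eq_square field_simps) algebra
  then have "(cmod (c - a * b / 2))\<^sup>2 = cmod (V\<^sup>2 + (4 - a\<^sup>2) * (4 - b\<^sup>2) / 4)"
    by (metis norm_power)
  also have "\<dots> \<le> (cmod V)\<^sup>2 + cmod (4 - a\<^sup>2) * cmod (4 - b\<^sup>2) / 4"
    by (rule order_trans[OF norm_triangle_ineq]) (simp add: norm_mult norm_divide norm_power)
  also have "\<dots> \<le> (cmod V)\<^sup>2 + 8 * 8 / 4"
    using four[OF assms(2)] four[OF assms(3)] by (intro add_left_mono divide_right_mono mult_mono) auto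
  also have "\<dots> \<le> (cmod V + 4)\<^sup>2" by (simp add: power2_eq_square algebra_simps)
  finally have "cmod (c - a * b / 2) \<le> cmod V + 4"
    by (rule power2_le_imp_le) simp
  moreover have "cmod (a * b / 2) \<le> 2"
    using mult_mono[OF assms(2,3)] by (simp add: norm_mult norm_divide)
  moreover have "cmod c \<le> cmod (c - a * b / 2) + cmod (a * b / 2)"
    by (metis diff_add_cancel norm_triangle_ineq)
  ultimately show ?thesis by linarith
qed

text \<open>Both neighbours of an entry exceeding \<open>2\<close> must be at most \<open>2\<close>,
  or the orbit could not return at \<open>K\<close>. The invariant, solved for the middle entry,
  then bounds it.\<close>

lemma fib_trace_bounded:
  fixes V z :: complex
  assumes "cmod (fib_trace V z K) \<le> 2" "j < K"
  shows "cmod (fib_trace V z j) \<le> 6 + cmod V"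
proof (cases "cmod (fib_trace V z j) \<le> 2")
  case True
  then show ?thesis by (simp add: add_nonneg_nonneg order_trans)
next
  case False
  then obtain i where i: "j = Suc i" by (cases j) auto
  have "cmod (fib_trace V z i) \<le> 2" "cmod (fib_trace V z (Suc j)) \<le> 2"
    using fib_trace_escape[of V z j K] fib_trace_escape[of V z i K] assms False i by force+
  moreover have "(fib_trace V z i)\<^sup>2 + (fib_trace V z (Suc (Suc i)))\<^sup>2 + (fib_trace V z (Suc i))\<^sup>2
      - fib_trace V z i * fib_trace V z (Suc (Suc i)) * fib_trace V z (Suc i) = 4 + V\<^sup>2"
    using fricke_vogt_invariant[of V z i] by (simp only: mult.commute mult.left_commute add_ac)
  ultimately show ?thesis using invariant_bound unfolding i by blast
qed

lemma fib_trace_stable: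
  fixes V z E :: complex
  assumes X: "\<And>j. j \<le> J \<Longrightarrow> cmod (fib_trace V E j) \<le> X" "X \<ge> 0"
    and "cmod (z - E) \<le> \<delta>" "(X + 2) ^ J * \<delta> \<le> 1" "j \<le> J"
  shows "cmod (fib_trace V z j - fib_trace V E j) \<le> (X + 2) ^ j * \<delta>"
  using \<open>j \<le> J\<close>
proof (induction j rule: less_induct)
  case (less j)
  define \<rho> where "\<rho> = X + 2"
  have \<rho>: "\<rho> \<ge> 1" using X(2) by (simp add: \<rho>_def)
  have \<delta>: "\<delta> \<ge> 0" using assms(3) norm_ge_zero order_trans by blast
  consider "j = 0" | "j = 1" | "j = 2" | i where "j = Suc (Suc (Suc i))"
    by (metis One_nat_def Suc_1 not0_implies_Suc)
  then show ?case
  proof cases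
    case 2
    then show ?thesis using assms(3) \<delta> mult_right_mono[of 1 \<rho> \<delta>] \<rho> by (simp add: \<rho>_def)
  next
    case 3
    have "1 * \<delta> \<le> \<rho>\<^sup>2 * \<delta>" using \<rho> \<delta> by (intro mult_right_mono one_le_power)
    then show ?thesis using 3 assms(3) by (simp add: \<rho>_def numeral_2_eq_2)
  next
    case (4 i)
    define d where "d k = cmod (fib_trace V z k - fib_trace V E k)" for k
    let ?a = "fib_trace V z (Suc (Suc i))" and ?b = "fib_trace V z (Suc i)" and ?c = "fib_trace V z i"
    let ?a' = "fib_trace V E (Suc (Suc i))" and ?b' = "fib_trace V E (Suc i)" and ?c' = "fib_trace V E i"
    have IH: "d i \<le> \<rho> ^ i * \<delta>" "d (Suc i) \<le> \<rho> ^ Suc i * \<delta>" "d (Suc (Suc i)) \<le> \<rho> ^ Suc (Suc i) * \<delta>"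
      using less.IH[of i] less.IH[of "Suc i"] less.IH[of "Suc (Suc i)"] less.prems 4
      by (simp_all add: d_def \<rho>_def)
    have "\<rho> ^ Suc (Suc i) * \<delta> \<le> \<rho> ^ J * \<delta>"
      using \<rho> \<delta> less.prems 4 by (intro mult_right_mono power_increasing) auto
    \<comment> \<open>An error of at most \<open>1\<close> makes the product of two errors linear;
      this is the purpose of the bound on \<open>(X + 2) ^ J * \<delta>\<close>.\<close>
    then have d1: "d (Suc (Suc i)) \<le> 1" using IH(3) assms(4) unfolding \<rho>_def by linarith
    have "fib_trace V z j - fib_trace V E j
        = ?a' * (?b - ?b') + ?b' * (?a - ?a') + (?a - ?a') * (?b - ?b') - (?c - ?c')"
      by (simp add: 4 algebra_simps)
    then have "d j \<le> cmod ?a' * d (Suc i) + cmod ?b' * d (Suc (Suc i)) + d (Suc (Suc i)) * d (Suc i) + d i"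
      unfolding d_def using norm_triangle_ineq4 norm_triangle_ineq norm_mult
      by (smt (verit, best))
    also have "\<dots> \<le> X * d (Suc i) + X * d (Suc (Suc i)) + 1 * d (Suc i) + d i"
      using X(1)[of "Suc i"] X(1)[of "Suc (Suc i)"] less.prems 4 d1
      by (intro add_mono mult_right_mono) (auto simp: d_def)
    also have "\<dots> = (X + 1) * d (Suc i) + X * d (Suc (Suc i)) + d i" by (simp add: algebra_simps)
    also have "\<dots> \<le> (X + 1) * (\<rho> ^ Suc i * \<delta>) + X * (\<rho> ^ Suc (Suc i) * \<delta>) + \<rho> ^ i * \<delta>"
      using IH X(2) by (intro add_mono mult_left_mono) auto
    also have "\<dots> = (\<rho> ^ i * \<delta>) * ((X + 1) * \<rho> + X * \<rho>\<^sup>2 + 1)"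
      by (simp add: power2_eq_square algebra_simps)
    also have "\<dots> \<le> (\<rho> ^ i * \<delta>) * \<rho> ^ 3"
    proof (rule mult_left_mono)
      show "(X + 1) * \<rho> + X * \<rho>\<^sup>2 + 1 \<le> \<rho> ^ 3"
        using X(2) by (simp add: \<rho>_def power2_eq_square power3_eq_cube algebra_simps)
    qed (use \<rho> \<delta> in auto)
    also have "\<dots> = \<rho> ^ j * \<delta>" by (simp add: 4 power3_eq_cube)
    finally show ?thesis by (simp add: d_def \<rho>_def)
  qed (use \<delta> in simp)
qed

section \<open>Real energies at which a late trace vanishes\<close>

lemma of_real_fib_trace:
  "of_real (fib_trace V E n) = (fib_trace (of_real V) (of_real E) n :: 'a::{real_algebra_1,comm_ring_1})"
  by (induction V E n rule: fib_trace.induct) simp_all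

lemma continuous_on_fib_trace:
  "continuous_on A (\<lambda>E. fib_trace V E n :: real)"
  by (induction V "0 :: real" n rule: fib_trace.induct) (auto intro!: continuous_intros)

text \<open>At such energies the orbit escapes from the start, so the product in the recursion
  dominates the subtracted term and fixes the sign.\<close>

lemma sgn_fib_trace:
  fixes V E :: real
  assumes "\<bar>E\<bar> > 2" "\<bar>E - V\<bar> > 2"
  shows "sgn (fib_trace V E (Suc (Suc (Suc i)))) = sgn (fib_trace V E (Suc (Suc i))) * sgn (fib_trace V E (Suc i))"
proof -
  define a b c where "a = fib_trace V E (Suc (Suc i))" "b = fib_trace V E (Suc i)" "c = fib_trace V E i"
  have e: "\<bar>b\<bar> > 2" "\<bar>a\<bar> > 2" "\<bar>c\<bar> \<le> \<bar>a\<bar>"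
    using trace_map_escape[of "fib_trace V E" i] assms
    by (auto simp: a_b_c_def numeral_2_eq_2)
  have "\<bar>a\<bar> * 2 \<le> \<bar>a\<bar> * \<bar>b\<bar>" using e by (intro mult_left_mono) auto
  then have "\<bar>c\<bar> < \<bar>a * b\<bar>" using e by (simp add: abs_mult)
  then have "sgn (a * b - c) = sgn (a * b)" by (auto simp: sgn_if)
  then show ?thesis by (simp add: a_b_c_def sgn_mult)
qed

text \<open>As \<open>fib (3 m + 1)\<close> is odd, this trace is a polynomial of odd degree in the energy.\<close>

lemma fib_trace_root:
  fixes V :: real
  assumes "V \<ge> 0"
  obtains E where "\<bar>E\<bar> \<le> 3 + V" "fib_trace V E (Suc (3 * m)) = 0"
proof -
  have pos: "sgn (fib_trace V (3 + V) (Suc i)) = 1 \<and> sgn (fib_trace V (3 + V) (Suc (Suc i))) = 1" for i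
    by (induction i) (use assms sgn_fib_trace[of "3 + V" V] in auto)
  \<comment> \<open>From index \<open>1\<close> on, the signs at the left end repeat as
    \<open>-1, -1, 1\<close>.\<close>
  have neg: "sgn (fib_trace V (- (3 + V)) (Suc (3 * i))) = -1 \<and> sgn (fib_trace V (- (3 + V)) (Suc (Suc (3 * i)))) = -1" for i
  proof (induction i)
    case (Suc i)
    note s = sgn_fib_trace[of "- (3 + V)" V]
    have s3: "sgn (fib_trace V (- (3 + V)) (Suc (Suc (Suc (3 * i))))) = 1"
      using Suc assms by (subst s) auto
    have s4: "sgn (fib_trace V (- (3 + V)) (Suc (Suc (Suc (Suc (3 * i)))))) = -1"
      using Suc s3 assms by (subst s) auto
    have s5: "sgn (fib_trace V (- (3 + V)) (Suc (Suc (Suc (Suc (Suc (3 * i))))))) = -1"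
      using s3 s4 assms by (subst s) auto
    have e: "3 * Suc i = Suc (Suc (Suc (3 * i)))" by simp
    show ?case unfolding e using s4 s5 by blast
  qed (use assms in auto)
  have ex: "\<exists>E. - (3 + V) \<le> E \<and> E \<le> 3 + V \<and> fib_trace V E (Suc (3 * m)) = 0"
  proof (rule IVT')
    show "fib_trace V (- (3 + V)) (Suc (3 * m)) \<le> 0" using neg[of m] by (auto simp: sgn_if split: if_splits)
    show "0 \<le> fib_trace V (3 + V) (Suc (3 * m))" using pos[of "3 * m"] by (auto simp: sgn_if split: if_splits)
  qed (use assms continuous_on_fib_trace in auto)
  have abs: "- (3 + V) \<le> E \<Longrightarrow> E \<le> 3 + V \<Longrightarrow> \<bar>E\<bar> \<le> 3 + V" for E by linarith
  show ?thesis using ex abs that by blast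
qed

text \<open>The root is taken at index \<open>3 * J + 1 > J\<close>, which bounds the earlier traces
  by \<open>6 + V\<close>. Stability with \<open>X = 6 + V\<close> has growth factor
  \<open>8 + V\<close> and costs at most \<open>1\<close> more.\<close>

lemma fib_trace_near_spectrum:
  fixes V :: real
  assumes "V \<ge> 0"
  obtains E :: real where "\<bar>E\<bar> \<le> 3 + V"
    "\<And>z j. cmod (z - of_real E) \<le> \<delta> \<Longrightarrow> (8 + V) ^ J * \<delta> \<le> 1 \<Longrightarrow> j \<le> J
      \<Longrightarrow> cmod (fib_trace (of_real V) z j) \<le> 7 + V"
proof -
  obtain E where E: "\<bar>E\<bar> \<le> 3 + V" "fib_trace V E (Suc (3 * J)) = 0"
    using fib_trace_root[OF assms] by blast
  have "cmod (fib_trace (of_real V) (of_real E) (Suc (3 * J))) \<le> 2"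
    unfolding of_real_fib_trace[symmetric] E(2) by simp
  then have X: "cmod (fib_trace (of_real V) (of_real E) j) \<le> 6 + V" if "j \<le> J" for j
    using fib_trace_bounded[of "of_real V" "of_real E" "Suc (3 * J)" j] that assms by auto
  have "cmod (fib_trace (of_real V) z j) \<le> 7 + V"
    if z: "cmod (z - of_real E) \<le> \<delta>" "(8 + V) ^ J * \<delta> \<le> 1" and "j \<le> J" for z j
  proof -
    have "\<delta> \<ge> 0" using z(1) norm_ge_zero order_trans by blast
    have "cmod (fib_trace (of_real V) z j - fib_trace (of_real V) (of_real E) j) \<le> (8 + V) ^ j * \<delta>"
      using fib_trace_stable[of J "of_real V" "of_real E" "6 + V" z \<delta> j] X z \<open>j \<le> J\<close> assms by simp
    also have "\<dots> \<le> (8 + V) ^ J * \<delta>"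
      using assms \<open>j \<le> J\<close> \<open>\<delta> \<ge> 0\<close> by (intro mult_right_mono power_increasing) auto
    finally have "cmod (fib_trace (of_real V) z j - fib_trace (of_real V) (of_real E) j) \<le> 1"
      using z(2) by simp
    then show ?thesis
      using X[OF \<open>j \<le> J\<close>] norm_triangle_sub[of "fib_trace (of_real V) z j" "fib_trace (of_real V) (of_real E) j"]
      by linarith
  qed
  then show ?thesis using that E(1) by blast
qed

section \<open>The unitary group and its Laplace transform\<close>

text \<open>Termwise differentiation: on a bounded interval around \<open>t\<close> and
  \<open>0\<close> the differentiated series converges uniformly by the M-test against an
  exponential series.\<close>

lemma exp_series_has_vector_derivative:
  fixes c :: "nat \<Rightarrow> 'b::banach"
  assumes c: "\<And>k. norm (c k) \<le> C * b ^ k" and "b \<ge> 0"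
  shows "((\<lambda>t. \<Sum>k. (t ^ k / fact k) *\<^sub>R c k) has_vector_derivative
           (\<Sum>k. (t ^ k / fact k) *\<^sub>R c (Suc k))) (at t)"
proof -
  define R where "R = \<bar>t\<bar> + 1"
  define S where "S = {-R<..<R}"
  define f' where "f' k x = (if k = 0 then 0 else (x ^ (k - 1) / fact (k - 1)) *\<^sub>R c k)" for k :: nat and x :: real
  have C: "C \<ge> 0" using order_trans[OF norm_ge_zero c[of 0]] by simp
  have term_bound: "norm ((x ^ k / fact k) *\<^sub>R c (k + j)) \<le> C * b ^ j * ((R * b) ^ k /\<^sub>R fact k)"
    if "x \<in> S" for x k j
  proof -
    have "norm ((x ^ k / fact k) *\<^sub>R c (k + j)) \<le> (R ^ k / fact k) * (C * b ^ (k + j))"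
      using c[of "k + j"] that C \<open>b \<ge> 0\<close>
      by (auto simp: S_def power_abs intro!: mult_mono divide_right_mono power_mono)
    then show ?thesis by (simp add: power_add power_mult_distrib divide_inverse mult_ac)
  qed
  have summ: "summable (\<lambda>k. C * b ^ j * ((R * b) ^ k /\<^sub>R fact k))" for j
    by (intro summable_mult summable_exp_generic)
  have sums: "(\<lambda>k. (x ^ k / fact k) *\<^sub>R c (k + j)) sums (\<Sum>k. (x ^ k / fact k) *\<^sub>R c (k + j))"
    if "x \<in> S" for x j
    by (intro summable_sums summable_comparison_test'[OF summ[of j]] term_bound that)
  have ulim: "uniform_limit S (\<lambda>n x. \<Sum>k<n. (x ^ k / fact k) *\<^sub>R c (k + 1))
      (\<lambda>x. \<Sum>k. (x ^ k / fact k) *\<^sub>R c (k + 1)) sequentially"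
    by (rule Weierstrass_m_test[OF term_bound summ])
  have "\<exists>g. \<forall>x\<in>S. (\<lambda>k. (x ^ k / fact k) *\<^sub>R c k) sums g x \<and>
      (g has_derivative (\<lambda>h. h *\<^sub>R (\<Sum>k. (x ^ k / fact k) *\<^sub>R c (k + 1)))) (at x within S)"
  proof (rule has_derivative_series[where f' = "\<lambda>k x h. h *\<^sub>R f' k x"])
    show "convex S" by (simp add: S_def)
    show "0 \<in> S" by (simp add: S_def R_def add_nonneg_pos)
    show "(\<lambda>k. ((0::real) ^ k / fact k) *\<^sub>R c k) sums (\<Sum>k. (0 ^ k / fact k) *\<^sub>R c k)"
      using sums[OF \<open>0 \<in> S\<close>, of 0] by simp
    fix k x assume "x \<in> S"
    have "((\<lambda>x. (x ^ k / fact k) *\<^sub>R c k) has_vector_derivative f' k x) (at x within S)"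
    proof (cases k)
      case 0
      then show ?thesis by (simp add: f'_def)
    next
      case (Suc j)
      have "((\<lambda>x. x ^ k / fact k) has_real_derivative (real k * x ^ j) / fact k) (at x within S)"
        by (auto intro!: derivative_eq_intros simp: Suc simp del: power_Suc)
      moreover have "(real k * x ^ j) / fact k = x ^ j / fact j"
        unfolding Suc fact_Suc by (simp del: of_nat_Suc)
      ultimately have "((\<lambda>x. x ^ k / fact k) has_real_derivative x ^ j / fact j) (at x within S)"
        by simp
      from has_vector_derivative_scaleR[OF this has_vector_derivative_const[of "c k"]]
      show ?thesis by (simp add: f'_def Suc)
    qed
    then show "((\<lambda>x. (x ^ k / fact k) *\<^sub>R c k) has_derivative (\<lambda>h. h *\<^sub>R f' k x)) (at x within S)"
      by (simp add: has_vector_derivative_def)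
  next
    fix e :: real assume "e > 0"
    have "\<forall>\<^sub>F n in sequentially. \<forall>x\<in>S. dist (\<Sum>k<n. (x ^ k / fact k) *\<^sub>R c (k + 1))
            (\<Sum>k. (x ^ k / fact k) *\<^sub>R c (k + 1)) < e"
      using uniform_limitD[OF ulim \<open>e > 0\<close>] .
    then have "\<forall>\<^sub>F n in sequentially. \<forall>x\<in>S. \<forall>h. norm ((\<Sum>k<Suc n. h *\<^sub>R f' k x)
        - h *\<^sub>R (\<Sum>k. (x ^ k / fact k) *\<^sub>R c (k + 1))) \<le> e * norm h"
    proof (rule eventually_mono, intro ballI allI)
      fix n x and h :: real
      assume *: "\<forall>x\<in>S. dist (\<Sum>k<n. (x ^ k / fact k) *\<^sub>R c (k + 1))
            (\<Sum>k. (x ^ k / fact k) *\<^sub>R c (k + 1)) < e" and "x \<in> S"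
      \<comment> \<open>The zeroth term is constant, so differentiation shifts the partial sums by
        one index.\<close>
      have "(\<Sum>k<Suc n. h *\<^sub>R f' k x) = h *\<^sub>R (\<Sum>k<n. (x ^ k / fact k) *\<^sub>R c (k + 1))"
        unfolding sum.lessThan_Suc_shift by (simp add: f'_def scaleR_sum_right)
      then have "norm ((\<Sum>k<Suc n. h *\<^sub>R f' k x) - h *\<^sub>R (\<Sum>k. (x ^ k / fact k) *\<^sub>R c (k + 1)))
          = \<bar>h\<bar> * dist (\<Sum>k<n. (x ^ k / fact k) *\<^sub>R c (k + 1)) (\<Sum>k. (x ^ k / fact k) *\<^sub>R c (k + 1))"
        by (simp add: dist_norm flip: scaleR_diff_right)
      also have "\<dots> \<le> e * norm h"
        using mult_left_mono[OF less_imp_le[OF *[rule_format, OF \<open>x \<in> S\<close>]], of "\<bar>h\<bar>"]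
        by (simp add: mult.commute)
      finally show "norm ((\<Sum>k<Suc n. h *\<^sub>R f' k x)
        - h *\<^sub>R (\<Sum>k. (x ^ k / fact k) *\<^sub>R c (k + 1))) \<le> e * norm h" .
    qed
    then show "\<forall>\<^sub>F n in sequentially. \<forall>x\<in>S. \<forall>h. norm ((\<Sum>k<n. h *\<^sub>R f' k x)
        - h *\<^sub>R (\<Sum>k. (x ^ k / fact k) *\<^sub>R c (k + 1))) \<le> e * norm h"
      by (subst (asm) eventually_sequentially_Suc)
  qed
  then obtain g where g: "\<And>x. x \<in> S \<Longrightarrow> (\<lambda>k. (x ^ k / fact k) *\<^sub>R c k) sums g x"
    "\<And>x. x \<in> S \<Longrightarrow> (g has_vector_derivative (\<Sum>k. (x ^ k / fact k) *\<^sub>R c (k + 1))) (at x within S)"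
    unfolding has_vector_derivative_def by blast
  have "t \<in> S" "open S" by (auto simp: S_def R_def)
  have "(g has_vector_derivative (\<Sum>k. (t ^ k / fact k) *\<^sub>R c (k + 1))) (at t)"
    using g(2)[OF \<open>t \<in> S\<close>] unfolding at_within_open[OF \<open>t \<in> S\<close> \<open>open S\<close>] .
  from this \<open>open S\<close> \<open>t \<in> S\<close> show ?thesis
    unfolding Suc_eq_plus1
  proof (rule has_vector_derivative_transform_within_open)
    show "g x = (\<Sum>k. (x ^ k / fact k) *\<^sub>R c k)" if "x \<in> S" for x
      by (rule sums_unique[OF g(1)[OF that]])
  qed
qed

definition generator :: "(ell2 \<Rightarrow>\<^sub>L ell2) \<Rightarrow> ell2 \<Rightarrow>\<^sub>L ell2" where
  "generator H = scalar_op (- \<i>) o\<^sub>L H"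

lemma coord_scalar_op [simp]: "coord (scalar_op c \<psi>) n = c * coord \<psi> n"
  by (simp add: scalar_op.rep_eq)

lemma coord_generator: "coord (generator H \<psi>) n = - \<i> * coord (H \<psi>) n"
  by (simp add: generator_def)

text \<open>Only the real factor \<open>t\<close> is pulled out: \<open>H\<close> is merely
  real-linear here, so the imaginary unit stays inside \<open>generator H\<close>.\<close>

lemma funpow_generator:
  "(((o\<^sub>L) (scalar_op (- \<i> * of_real t) o\<^sub>L H) ^^ k) id_blinfun)
     = t ^ k *\<^sub>R (((o\<^sub>L) (generator H) ^^ k) id_blinfun)"
proof -
  have "scalar_op (- \<i> * of_real t) o\<^sub>L H = t *\<^sub>R generator H"
    by (intro blinfun_eqI ell2_eqI) (simp add: coord_generator blinfun.scaleR_left scaleR_conv_of_real)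
  then show ?thesis
    by (induction k) (auto intro!: blinfun_eqI simp: blinfun.scaleR_left blinfun.scaleR_right)
qed

lemma unitary_group_series:
  "unitary_group H t \<psi> = (\<Sum>k. (t ^ k / fact k) *\<^sub>R (((o\<^sub>L) (generator H) ^^ k) id_blinfun \<psi>))"
proof -
  define A where "A = scalar_op (- \<i> * of_real t) o\<^sub>L H"
  have "unitary_group H t \<psi> = (\<Sum>k. blinfun_apply ((((o\<^sub>L) A ^^ k) id_blinfun) /\<^sub>R fact k) \<psi>)"
    unfolding unitary_group_def blinfun_exp_def A_def[symmetric]
    by (rule bounded_linear.suminf[OF blinfun.bounded_linear_left summable_blinfun_exp])
  then show ?thesis
    unfolding A_def funpow_generator by (simp add: blinfun.scaleR_left divide_inverse mult.commute)
qed

lemma norm_funpow_blinfun: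
  fixes A :: "'a::real_normed_vector \<Rightarrow>\<^sub>L 'a"
  shows "norm (((o\<^sub>L) A ^^ k) id_blinfun x) \<le> norm x * norm A ^ k"
proof (induction k)
  case (Suc k)
  have "norm (((o\<^sub>L) A ^^ Suc k) id_blinfun x) \<le> norm A * norm (((o\<^sub>L) A ^^ k) id_blinfun x)"
    by (simp add: norm_blinfun)
  also have "\<dots> \<le> norm A * (norm x * norm A ^ k)"
    by (intro mult_left_mono Suc.IH) auto
  finally show ?case by (simp add: mult_ac)
qed simp

lemma unitary_group_has_vector_derivative:
  "((\<lambda>t. unitary_group H t \<psi>) has_vector_derivative generator H (unitary_group H t \<psi>)) (at t)"
proof -
  let ?c = "\<lambda>k. ((o\<^sub>L) (generator H) ^^ k) id_blinfun \<psi>"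
  have "(\<Sum>k. (t ^ k / fact k) *\<^sub>R ?c (Suc k)) = (\<Sum>k. generator H ((t ^ k / fact k) *\<^sub>R ?c k))"
    by (simp add: blinfun.scaleR_right)
  also have "\<dots> = generator H (\<Sum>k. (t ^ k / fact k) *\<^sub>R ?c k)"
  proof (rule bounded_linear.suminf[OF blinfun.bounded_linear_right, symmetric])
    show "summable (\<lambda>k. (t ^ k / fact k) *\<^sub>R ?c k)"
    proof (rule summable_comparison_test')
      show "summable (\<lambda>k. norm \<psi> * ((\<bar>t\<bar> * norm (generator H)) ^ k /\<^sub>R fact k))"
        by (intro summable_mult summable_exp_generic)
      fix k
      have "norm ((t ^ k / fact k) *\<^sub>R ?c k) \<le> (\<bar>t\<bar> ^ k / fact k) * (norm \<psi> * norm (generator H) ^ k)"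
        using norm_funpow_blinfun[where A = "generator H" and x = \<psi> and k = k]
        by (simp add: power_abs mult_left_mono divide_right_mono)
      then show "norm ((t ^ k / fact k) *\<^sub>R ?c k) \<le> norm \<psi> * ((\<bar>t\<bar> * norm (generator H)) ^ k /\<^sub>R fact k)"
        by (simp add: power_mult_distrib divide_inverse mult_ac)
    qed
  qed
  finally show ?thesis
    unfolding unitary_group_series
    using exp_series_has_vector_derivative[of ?c "norm \<psi>" "norm (generator H)" t]
      norm_funpow_blinfun[where A = "generator H" and x = \<psi>] by simp
qed

lemma unitary_group_0: "unitary_group H 0 \<psi> = \<psi>"
proof -
  have "(\<Sum>k. (0 ^ k / fact k) *\<^sub>R (((o\<^sub>L) (generator H) ^^ k) id_blinfun \<psi>))
      = (\<Sum>k\<in>{0}. (0 ^ k / fact k) *\<^sub>R (((o\<^sub>L) (generator H) ^^ k) id_blinfun \<psi>))"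
    by (rule suminf_finite) auto
  then show ?thesis by (simp add: unitary_group_series)
qed

text \<open>Self-adjointness makes \<open>cinner_ell2 (H \<phi>) \<phi>\<close> real. Hence
  \<open>generator H \<phi>\<close> is orthogonal to \<open>\<phi>\<close> in the real inner
  product, and the squared norm has derivative \<open>0\<close>.\<close>

lemma norm_unitary_group:
  fixes H :: "ell2 \<Rightarrow>\<^sub>L ell2"
  assumes selfadjoint: "\<And>\<phi> \<psi>. cinner_ell2 \<phi> (H \<psi>) = cinner_ell2 (H \<phi>) \<psi>"
  shows "norm (unitary_group H t \<psi>) = norm \<psi>"
proof -
  have skew: "inner (generator H \<phi>) \<phi> = 0" for \<phi>
  proof -
    have "cnj (cinner_ell2 \<phi> (H \<phi>)) = cinner_ell2 (H \<phi>) \<phi>"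
      unfolding cinner_ell2_def by (simp add: infsum_cnj[symmetric] mult.commute)
    then have "Im (cinner_ell2 (H \<phi>) \<phi>) = 0"
      unfolding selfadjoint by (metis Reals_cnj_iff complex_is_Real_iff)
    moreover have "cinner_ell2 (generator H \<phi>) \<phi> = \<i> * cinner_ell2 (H \<phi>) \<phi>"
      unfolding cinner_ell2_def by (simp add: coord_generator mult.assoc infsum_cmult_right')
    ultimately show ?thesis by (simp add: inner_ell2_def)
  qed
  define N where "N t = inner (unitary_group H t \<psi>) (unitary_group H t \<psi>)" for t
  have "(N has_real_derivative 0) (at t)" for t
  proof -
    have d: "((\<lambda>t. unitary_group H t \<psi>) has_derivative (\<lambda>h. h *\<^sub>R generator H (unitary_group H t \<psi>))) (at t)"
      using unitary_group_has_vector_derivative unfolding has_vector_derivative_def .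
    show ?thesis
      using has_derivative_inner[OF d d] unfolding N_def has_field_derivative_def
      by (simp add: skew inner_commute[of "unitary_group H t \<psi>"] lambda_zero)
  qed
  then have "N t = N 0" using DERIV_isconst_all by blast
  then show ?thesis by (simp add: N_def unitary_group_0 norm_eq_sqrt_inner)
qed

lemma bounded_linear_coord: "bounded_linear (\<lambda>\<psi>. coord \<psi> n)"
  by (rule bounded_linear_intro[where K = 1]) (auto simp: cmod_coord_le_norm)

lemma coord_unitary_group_has_vector_derivative:
  "((\<lambda>t. coord (unitary_group H t \<psi>) n) has_vector_derivative
     - \<i> * coord (H (unitary_group H t \<psi>)) n) (at t)"
  using bounded_linear.has_vector_derivative[OF bounded_linear_coord unitary_group_has_vector_derivative]
  by (simp add: coord_generator)

section \<open>Laplace transforms on the half-line\<close>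

lemma
  fixes \<epsilon> :: real
  assumes "\<epsilon> > 0"
  shows set_integrable_exp_neg: "set_integrable lborel {0<..} (\<lambda>t. exp (- \<epsilon> * t))"
    and set_integral_exp_neg: "(LINT t:{0<..}|lborel. exp (- \<epsilon> * t)) = 1 / \<epsilon>"
proof -
  have l: "((\<lambda>t. - exp (- \<epsilon> * t) / \<epsilon>) \<longlongrightarrow> - (0 / \<epsilon>)) at_top"
    using assms by real_asymp
  have "((\<lambda>t. - exp (- \<epsilon> * t) / \<epsilon>) \<longlongrightarrow> - inverse \<epsilon>) (at_right 0)"
    using assms by real_asymp
  then have r: "((\<lambda>t. - exp (- \<epsilon> * t) / \<epsilon>) \<longlongrightarrow> - exp (- \<epsilon> * 0) / \<epsilon>) (at_right 0)"
    by (simp add: divide_inverse)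
  have "set_integrable lborel (einterval (ereal 0) \<infinity>) (\<lambda>t. exp (- \<epsilon> * t))"
    "(LBINT t=ereal 0..\<infinity>. exp (- \<epsilon> * t)) = - (0 / \<epsilon>) - - exp (- \<epsilon> * 0) / \<epsilon>"
    by (rule interval_integral_FTC_nonneg[where F = "\<lambda>t. - exp (- \<epsilon> * t) / \<epsilon>"];
        use assms l r in \<open>auto intro!: derivative_eq_intros continuous_intros simp: ereal_tendsto_simps\<close>)+
  then show "set_integrable lborel {0<..} (\<lambda>t. exp (- \<epsilon> * t))"
    "(LINT t:{0<..}|lborel. exp (- \<epsilon> * t)) = 1 / \<epsilon>"
    by (simp_all add: interval_lebesgue_integral_def)
qed

lemma set_integrable_exp_neg_bounded:
  fixes f :: "real \<Rightarrow> 'a::{banach, second_countable_topology}"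
  assumes "\<epsilon> > 0" "continuous_on UNIV f" "\<And>t. t > 0 \<Longrightarrow> norm (f t) \<le> B * exp (- \<epsilon> * t)"
  shows "set_integrable lborel {0<..} f"
proof (rule set_integrable_bound)
  show "set_integrable lborel {0<..} (\<lambda>t. B * exp (- \<epsilon> * t))"
    using set_integrable_exp_neg[OF assms(1)] by simp
  show "set_borel_measurable lborel {0<..} f"
    using borel_measurable_continuous_onI[OF assms(2)] unfolding set_borel_measurable_def by measurable
  show "AE x in lborel. x \<in> {0<..} \<longrightarrow> norm (f x) \<le> norm (B * exp (- \<epsilon> * x))"
    using order_trans[OF assms(3) abs_ge_self] by auto
qed

text \<open>Cauchy-Schwarz for the density \<open>exp (- Im z * t)\<close>, whose total mass is
  \<open>1 / Im z\<close>.\<close>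

lemma laplace_transform_bound:
  fixes y :: "real \<Rightarrow> complex"
  assumes y: "continuous_on UNIV y" "\<And>t. cmod (y t) \<le> 1" and z: "Im z > 0"
  shows "ennreal (Im z * (cmod (LINT t:{0<..}|lborel. exp (\<i> * z * of_real t) * y t))\<^sup>2)
     \<le> (\<integral>\<^sup>+t\<in>{0..}. ennreal (exp (- Im z * t) * (cmod (y t))\<^sup>2) \<partial>lborel)"
proof -
  define \<epsilon> where "\<epsilon> = Im z"
  have \<epsilon>: "\<epsilon> > 0" using z by (simp add: \<epsilon>_def)
  define u where "u = (LINT t:{0<..}|lborel. exp (\<i> * z * of_real t) * y t)"
  define c where "c = cmod u"
  define I where "I = (LINT t:{0<..}|lborel. exp (- \<epsilon> * t) * (cmod (y t))\<^sup>2)"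
  have e: "cmod (exp (\<i> * z * of_real t)) = exp (- \<epsilon> * t)" for t
    by (simp add: \<epsilon>_def)
  have y2: "(cmod (y t))\<^sup>2 \<le> 1" for t using y(2)[of t] by (simp add: power_le_one)
  have int1: "set_integrable lborel {0<..} (\<lambda>t. exp (\<i> * z * of_real t) * y t)"
    by (rule set_integrable_exp_neg_bounded[OF \<epsilon>, where B = 1])
      (use y in \<open>auto simp: norm_mult e mult_left_le simp del: norm_exp_eq_Re intro!: continuous_intros\<close>)
  have int2: "set_integrable lborel {0<..} (\<lambda>t. exp (- \<epsilon> * t) * (cmod (y t))\<^sup>2)"
    by (rule set_integrable_exp_neg_bounded[OF \<epsilon>, where B = 1])
      (use y y2 in \<open>auto simp: mult_left_le intro!: continuous_intros\<close>)
  have int3: "set_integrable lborel {0<..} (\<lambda>t. exp (- \<epsilon> * t) * cmod (y t))"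
    by (rule set_integrable_exp_neg_bounded[OF \<epsilon>, where B = 1])
      (use y in \<open>auto simp: mult_left_le intro!: continuous_intros\<close>)
  have "I \<ge> 0" unfolding I_def set_lebesgue_integral_def by (intro Bochner_Integration.integral_nonneg) auto
  have key: "\<epsilon> * c\<^sup>2 \<le> I"
  proof (cases "c = 0")
    case False
    then have c: "c > 0" by (simp add: c_def)
    have "c \<le> (LINT t:{0<..}|lborel. exp (- \<epsilon> * t) * cmod (y t))"
      using integral_norm_bound[of lborel "\<lambda>t. indicator {0<..} t *\<^sub>R (exp (\<i> * z * of_real t) * y t)"]
      unfolding c_def u_def set_lebesgue_integral_def by (simp add: norm_mult e del: norm_exp_eq_Re)
    also have "\<dots> \<le> (LINT t:{0<..}|lborel. (1 / (2 * c * \<epsilon>)) * (exp (- \<epsilon> * t) * (cmod (y t))\<^sup>2)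
        + (c * \<epsilon> / 2) * exp (- \<epsilon> * t))"
    proof (rule set_integral_mono)
      show "set_integrable lborel {0<..} (\<lambda>t. (1 / (2 * c * \<epsilon>)) * (exp (- \<epsilon> * t) * (cmod (y t))\<^sup>2)
        + (c * \<epsilon> / 2) * exp (- \<epsilon> * t))"
        using int2 set_integrable_exp_neg[OF \<epsilon>] by (intro set_integral_add set_integrable_mult_right) auto
      fix t :: real
      \<comment> \<open>Young's inequality with weight \<open>c * \<epsilon>\<close>; integration
        gives \<open>c \<le> I / (2 * c * \<epsilon>) + c / 2\<close>, which is the claim.\<close>
      have "0 \<le> (cmod (y t) - c * \<epsilon>)\<^sup>2 / (2 * c * \<epsilon>)" using c \<epsilon> by simp
      then have "cmod (y t) \<le> (1 / (2 * c * \<epsilon>)) * (cmod (y t))\<^sup>2 + c * \<epsilon> / 2"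
        using c \<epsilon> by (simp add: field_simps power2_eq_square)
      then have "exp (- \<epsilon> * t) * cmod (y t) \<le> exp (- \<epsilon> * t) * ((1 / (2 * c * \<epsilon>)) * (cmod (y t))\<^sup>2 + c * \<epsilon> / 2)"
        by (intro mult_left_mono) auto
      then show "exp (- \<epsilon> * t) * cmod (y t) \<le> (1 / (2 * c * \<epsilon>)) * (exp (- \<epsilon> * t) * (cmod (y t))\<^sup>2)
        + (c * \<epsilon> / 2) * exp (- \<epsilon> * t)" by (simp add: algebra_simps)
    qed (rule int3)
    also have "\<dots> = (1 / (2 * c * \<epsilon>)) * I + (c * \<epsilon> / 2) * (1 / \<epsilon>)"
      using int2 set_integrable_exp_neg[OF \<epsilon>] set_integral_exp_neg[OF \<epsilon>]
      by (subst set_integral_add) (auto simp: I_def)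
    finally show ?thesis using c \<epsilon> by (simp add: field_simps power2_eq_square)
  qed (use \<open>I \<ge> 0\<close> in simp)
  have "ennreal I = (\<integral>\<^sup>+t. ennreal (indicator {0<..} t *\<^sub>R (exp (- \<epsilon> * t) * (cmod (y t))\<^sup>2)) \<partial>lborel)"
    unfolding I_def set_lebesgue_integral_def
    using int2 unfolding set_integrable_def by (intro nn_integral_eq_integral[symmetric]) auto
  also have "\<dots> \<le> (\<integral>\<^sup>+t\<in>{0..}. ennreal (exp (- \<epsilon> * t) * (cmod (y t))\<^sup>2) \<partial>lborel)"
    by (intro nn_integral_mono) (auto simp: indicator_def)
  finally show ?thesis
    using ennreal_leI[OF key] unfolding c_def u_def \<epsilon>_def by (rule order_trans[rotated])
qed

text \<open>Integration by parts: the boundary term vanishes at infinity because \<open>y\<close> is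
  bounded and \<open>Im z > 0\<close>.\<close>

lemma laplace_transform_derivative:
  fixes y y' :: "real \<Rightarrow> complex"
  assumes y: "\<And>t. cmod (y t) \<le> 1" and y': "continuous_on UNIV y'" "\<And>t. cmod (y' t) \<le> B"
    and deriv: "\<And>t. (y has_vector_derivative y' t) (at t)" and z: "Im z > 0"
  shows "\<i> * z * (LINT t:{0<..}|lborel. exp (\<i> * z * of_real t) * y t)
     + (LINT t:{0<..}|lborel. exp (\<i> * z * of_real t) * y' t) = - y 0"
proof -
  have e: "cmod (exp (\<i> * z * of_real t)) = exp (- Im z * t)" for t
    by simp
  have yc: "isCont y t" for t
    using deriv has_vector_derivative_continuous by blast
  then have yc': "continuous_on UNIV y" by (simp add: continuous_on_eq_continuous_at)
  have y'c: "isCont y' t" for t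
    using y'(1) by (simp add: continuous_on_eq_continuous_at)
  let ?e = "\<lambda>t. exp (\<i> * z * of_real t)"
  let ?f = "\<lambda>t. \<i> * z * (?e t * y t) + ?e t * y' t"
  have int1: "set_integrable lborel {0<..} (\<lambda>t. ?e t * y t)"
    by (rule set_integrable_exp_neg_bounded[OF z, where B = 1])
      (use y yc' in \<open>auto simp: norm_mult e mult_left_le simp del: norm_exp_eq_Re intro!: continuous_intros\<close>)
  have int2: "set_integrable lborel {0<..} (\<lambda>t. ?e t * y' t)"
  proof (rule set_integrable_exp_neg_bounded[OF z, where B = B])
    show "cmod (?e t * y' t) \<le> B * exp (- Im z * t)" for t
      unfolding norm_mult e using mult_right_mono[OF y'(2)[of t], of "exp (- Im z * t)"]
      by (simp add: mult.commute)
  qed (use y' in \<open>auto intro!: continuous_intros\<close>)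
  have int: "set_integrable lborel (einterval (ereal 0) \<infinity>) ?f"
    using int1 int2 by (auto intro!: set_integral_add)
  have lim0: "((\<lambda>t. ?e t * y t) \<longlongrightarrow> y 0) (at_right 0)"
  proof -
    have "isCont (\<lambda>t. ?e t * y t) 0" using yc by (intro continuous_intros)
    then have "((\<lambda>t. ?e t * y t) \<longlongrightarrow> ?e 0 * y 0) (at 0)" unfolding isCont_def .
    then show ?thesis by (simp add: filterlim_at_split)
  qed
  have lim1: "((\<lambda>t. ?e t * y t) \<longlongrightarrow> 0) at_top"
  proof (rule Lim_null_comparison)
    show "\<forall>\<^sub>F t in at_top. norm (?e t * y t) \<le> exp (- Im z * t)"
      using y by (simp add: norm_mult e mult_left_le del: norm_exp_eq_Re)
    show "((\<lambda>t. exp (- Im z * t)) \<longlongrightarrow> 0) at_top" using z by real_asymp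
  qed
  have "(LBINT t=ereal 0..\<infinity>. ?f t) = 0 - y 0"
  proof (rule interval_integral_FTC_integrable[where F = "\<lambda>t. ?e t * y t"])
    show "((\<lambda>t. ?e t * y t) has_vector_derivative ?f t) (at t)" for t
    proof -
      have "(?e has_vector_derivative (\<i> * z * ?e t)) (at t)"
        by (rule has_vector_derivative_real_field) (auto intro!: derivative_eq_intros)
      from has_vector_derivative_mult[OF this deriv[of t]] show ?thesis
        by (simp add: algebra_simps)
    qed
    show "isCont ?f t" for t using yc y'c by (intro continuous_intros) auto
  qed (use int lim0 lim1 in \<open>simp_all add: ereal_tendsto_simps\<close>)
  then have "(LINT t:{0<..}|lborel. ?f t) = - y 0"
    by (simp add: interval_lebesgue_integral_def)
  then show ?thesis
    using int1 int2 by (simp add: set_integral_add)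
qed

section \<open>Lower bounds for the Green function\<close>

text \<open>Reflection turns floors into ceilings; one small decrease of the phase turns finitely
  many of them back. The extra element \<open>1\<close> keeps the minimum defined for empty
  \<open>A\<close>.\<close>

lemma floor_diff_small:
  fixes A :: "real set"
  assumes "finite A"
  obtains \<eta> where "\<And>y. y \<in> A \<Longrightarrow> \<lfloor>y - \<eta>\<rfloor> = \<lceil>y\<rceil> - 1"
proof -
  define \<eta> where "\<eta> = Min (insert 1 ((\<lambda>y. y - of_int (\<lceil>y\<rceil> - 1)) ` A))"
  have fin: "finite (insert 1 ((\<lambda>y. y - of_int (\<lceil>y\<rceil> - 1)) ` A))" using assms by simp
  have "0 < y - of_int (\<lceil>y\<rceil> - 1)" for y :: real by linarith
  then have "\<eta> > 0" unfolding \<eta>_def using fin by (subst Min_gr_iff) auto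
  have "\<lfloor>y - \<eta>\<rfloor> = \<lceil>y\<rceil> - 1" if "y \<in> A" for y
  proof -
    have "\<eta> \<le> y - of_int (\<lceil>y\<rceil> - 1)" unfolding \<eta>_def using fin that by (intro Min_le) auto
    then show ?thesis using \<open>\<eta> > 0\<close> by (intro floor_unique) linarith+
  qed
  then show ?thesis using that by blast
qed

text \<open>Since the floor of \<open>- x\<close> is minus the ceiling of \<open>x\<close>, the
  reversed coding uses ceilings, and the phase \<open>- \<omega> - golden_alpha - \<eta>\<close>
  restores floors. The finite window suffices because only \<open>2 * fib J\<close> sites are
  used.\<close>

lemma fib_word_reflect:
  obtains \<omega>' where "\<And>n. 1 \<le> n \<Longrightarrow> n \<le> L \<Longrightarrow> fib_word \<omega> (- n) = fib_word \<omega>' n"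
proof -
  obtain \<eta> where \<eta>: "\<And>y. y \<in> (\<lambda>n::int. of_int n * golden_alpha - \<omega>) ` {0..L} \<Longrightarrow> \<lfloor>y - \<eta>\<rfloor> = \<lceil>y\<rceil> - 1"
    using floor_diff_small[of "(\<lambda>n::int. of_int n * golden_alpha - \<omega>) ` {0..L}"] by auto
  have "fib_word \<omega> (- n) = fib_word (- \<omega> - golden_alpha - \<eta>) n" if n: "1 \<le> n" "n \<le> L" for n
  proof -
    have a: "\<lfloor>of_int n * golden_alpha - \<omega> - \<eta>\<rfloor> = \<lceil>of_int n * golden_alpha - \<omega>\<rceil> - 1"
      and b: "\<lfloor>of_int (n - 1) * golden_alpha - \<omega> - \<eta>\<rfloor> = \<lceil>of_int (n - 1) * golden_alpha - \<omega>\<rceil> - 1"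
      by (rule \<eta>, rule imageI, use n in simp)+
    have e: "of_int (n + 1) * golden_alpha + (- \<omega> - golden_alpha - \<eta>) = of_int n * golden_alpha - \<omega> - \<eta>"
      "of_int n * golden_alpha + (- \<omega> - golden_alpha - \<eta>) = of_int (n - 1) * golden_alpha - \<omega> - \<eta>"
      "of_int (- n + 1) * golden_alpha + \<omega> = - (of_int (n - 1) * golden_alpha - \<omega>)"
      "of_int (- n) * golden_alpha + \<omega> = - (of_int n * golden_alpha - \<omega>)"
      by (simp_all add: algebra_simps)
    show ?thesis unfolding fib_word_def e a b by (simp add: ceiling_def)
  qed
  then show ?thesis using that by blast
qed

text \<open>Gordon's identity bounds \<open>w m\<close> by \<open>X\<close> times the value one
  period away plus the value two periods away; the larger of the two serves.\<close>

lemma one_sided_lower_bound: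
  fixes w :: "int \<Rightarrow> complex" and V \<omega> :: real
  assumes "J \<ge> 7" and X: "\<And>j. j \<le> J \<Longrightarrow> cmod (fib_trace (of_real V) z j) \<le> X"
    and rec: "\<And>n. 1 \<le> n \<Longrightarrow> n \<le> 2 * int (fib J) \<Longrightarrow>
      w (n + 1) = (z - of_real V * of_int (fib_word \<omega> n)) * w n - w (n - 1)"
    and m: "m = 0 \<or> m = 1"
  shows "\<exists>n\<ge>int (fib (J - 3)). cmod (w m) \<le> (X + 1) * cmod (w n)"
proof -
  \<comment> \<open>The levels \<open>k0, ..., k0 + 3\<close> have periods from
    \<open>fib (J - 3)\<close> to \<open>fib J\<close>, and \<open>J \<ge> 7\<close> makes each of
    them at least \<open>3\<close>, as \<open>trace_fib_word\<close> requires.\<close>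
  define k0 where "k0 = J - 4"
  have "k0 \<ge> 1" using assms(1) by (simp add: k0_def)
  then obtain k where k: "k \<in> {k0..k0 + 3}" "fib_square \<omega> k"
    using fib_square_exists by blast
  define q where "q = fib (Suc k)"
  have kJ: "k \<ge> 3" "Suc k \<le> J" "J - 3 \<le> Suc k" using k(1) assms(1) by (auto simp: k0_def)
  have qJ: "q \<le> fib J" "fib (J - 3) \<le> q" unfolding q_def using kJ by (auto intro: fib_mono)
  let ?f = "\<lambda>n. z - of_real V * of_int (fib_word \<omega> n)"
  have tr: "trace (word_mat ?f 0 q) = fib_trace (of_real V) z (Suc k)"
    unfolding q_def using kJ(1) k(2) by (rule trace_fib_word)
  have rec': "w (n + 1) = ?f n * w n - w (n - 1)" if "1 \<le> n" "n \<le> 2 * int q" for n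
    using rec[of n] that qJ by auto
  have per: "?f (n + int q) = ?f n" if "1 \<le> n" "n \<le> int q" for n
    using fib_word_square[OF k(2)] that by (simp add: q_def)
  have "w (2 * int q + m) = fib_trace (of_real V) z (Suc k) * w (int q + m) - w m"
    using gordon[of q w ?f, OF rec' per] m unfolding tr by auto
  then have "w m = fib_trace (of_real V) z (Suc k) * w (int q + m) - w (2 * int q + m)" by simp
  then have "cmod (w m) \<le> cmod (fib_trace (of_real V) z (Suc k)) * cmod (w (int q + m)) + cmod (w (2 * int q + m))"
    by (metis norm_mult norm_triangle_ineq4)
  also have "\<dots> \<le> X * cmod (w (int q + m)) + cmod (w (2 * int q + m))"
    by (intro add_right_mono mult_right_mono X kJ) auto
  finally have *: "cmod (w m) \<le> X * cmod (w (int q + m)) + cmod (w (2 * int q + m))" .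
  have X0: "X \<ge> 0" using X[of 0] norm_ge_zero order_trans by blast
  show ?thesis
  proof (cases "cmod (w (int q + m)) \<le> cmod (w (2 * int q + m))")
    case True
    then have "X * cmod (w (int q + m)) \<le> X * cmod (w (2 * int q + m))" using X0 by (rule mult_left_mono)
    then have "cmod (w m) \<le> (X + 1) * cmod (w (2 * int q + m))" using * by (simp add: algebra_simps)
    then show ?thesis using qJ m by (intro exI[of _ "2 * int q + m"]) auto
  next
    case False
    then have "cmod (w m) \<le> (X + 1) * cmod (w (int q + m))" using * by (simp add: algebra_simps)
    then show ?thesis using qJ m by (intro exI[of _ "int q + m"]) auto
  qed
qed

text \<open>The source at site \<open>0\<close> forces one of \<open>u 0\<close>,
  \<open>u 1\<close>, \<open>u (- 1)\<close> to have modulus at least \<open>1 / (R + 2)\<close>.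
  Off the origin the equation is homogeneous, so the one-sided bound carries this value outwards: to
  the right for the first two, to the left for the third.\<close>

lemma two_sided_lower_bound:
  fixes u :: "int \<Rightarrow> complex" and V \<omega> :: real
  assumes "J \<ge> 7" and X: "\<And>j. j \<le> J \<Longrightarrow> cmod (fib_trace (of_real V) z j) \<le> X"
    and green: "\<And>n. u (n + 1) + u (n - 1) + of_real (fib_potential V \<omega> n) * u n - z * u n = (if n = 0 then 1 else 0)"
    and R: "\<bar>V\<bar> + cmod z \<le> R"
  shows "\<exists>n. int (fib (J - 3)) \<le> \<bar>n\<bar> \<and> 1 \<le> (R + 2) * (X + 1) * cmod (u n)"
proof -
  have R0: "R \<ge> 0" using R abs_ge_zero[of V] norm_ge_zero[of z] by linarith
  have X0: "X \<ge> 0" using X[of 0] norm_ge_zero order_trans by blast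
  have right: "\<exists>n\<ge>int (fib (J - 3)). cmod (u m) \<le> (X + 1) * cmod (u n)" if "m = 0 \<or> m = 1" for m
  proof (rule one_sided_lower_bound[OF assms(1) X _ that])
    show "u (n + 1) = (z - of_real V * of_int (fib_word \<omega> n)) * u n - u (n - 1)" if "1 \<le> n" for n
      using green[of n] that by (simp add: fib_potential_eq algebra_simps add_eq_0_iff2)
  qed auto
  have left: "\<exists>n\<ge>int (fib (J - 3)). cmod (u (- 1)) \<le> (X + 1) * cmod (u (- n))"
  proof -
    obtain \<omega>' where \<omega>': "\<And>n. 1 \<le> n \<Longrightarrow> n \<le> 2 * int (fib J) \<Longrightarrow> fib_word \<omega> (- n) = fib_word \<omega>' n"
      using fib_word_reflect by blast
    show ?thesis
    proof (rule one_sided_lower_bound[OF assms(1) X, where w = "\<lambda>n. u (- n)" and m = 1 and \<omega> = \<omega>'])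
      fix n assume n: "1 \<le> n" "n \<le> 2 * int (fib J)"
      then have "u (- n + 1) + u (- n - 1) + of_real (V * of_int (fib_word \<omega>' n)) * u (- n) - z * u (- n) = 0"
        using green[of "- n"] \<omega>'[OF n] by (simp add: fib_potential_eq)
      moreover have "- (n + 1) = - n - 1" "- (n - 1) = - n + 1" by simp_all
      ultimately show "u (- (n + 1)) = (z - of_real V * of_int (fib_word \<omega>' n)) * u (- n) - u (- (n - 1))"
        by (simp only: of_real_mult of_real_of_int_eq) (simp add: algebra_simps add_eq_0_iff2)
    qed auto
  qed
  define B where "B = max (cmod (u 0)) (max (cmod (u 1)) (cmod (u (- 1))))"
  have "1 = cmod (u 1 + u (- 1) + (of_real (fib_potential V \<omega> 0) * u 0 - z * u 0))"
    using green[of 0] by (simp add: add_diff_eq)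
  also have "\<dots> \<le> cmod (u 1) + cmod (u (- 1)) + (\<bar>fib_potential V \<omega> 0\<bar> * cmod (u 0) + cmod z * cmod (u 0))"
    by (intro norm_triangle_le add_mono order_trans[OF norm_triangle_ineq4]) (auto simp: norm_mult)
  also have "\<dots> \<le> B + B + (\<bar>V\<bar> * B + cmod z * B)"
    by (intro add_mono mult_mono abs_fib_potential_le) (auto simp: B_def)
  also have "\<dots> = (\<bar>V\<bar> + cmod z) * B + 2 * B" by (simp add: algebra_simps)
  also have "\<dots> \<le> R * B + 2 * B" using R by (intro add_right_mono mult_right_mono) (auto simp: B_def le_max_iff_disj)
  finally have B: "1 \<le> (R + 2) * B" by (simp add: algebra_simps)
  have "\<exists>n. int (fib (J - 3)) \<le> \<bar>n\<bar> \<and> B \<le> (X + 1) * cmod (u n)"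
  proof -
    consider "B = cmod (u 0)" | "B = cmod (u 1)" | "B = cmod (u (- 1))" unfolding B_def by linarith
    then show ?thesis
    proof cases
      case 1
      with right[of 0] obtain n where "n \<ge> int (fib (J - 3))" "B \<le> (X + 1) * cmod (u n)" by auto
      then show ?thesis by (intro exI[of _ n]) auto
    next
      case 2
      with right[of 1] obtain n where "n \<ge> int (fib (J - 3))" "B \<le> (X + 1) * cmod (u n)" by auto
      then show ?thesis by (intro exI[of _ n]) auto
    next
      case 3
      with left obtain n where "n \<ge> int (fib (J - 3))" "B \<le> (X + 1) * cmod (u (- n))" by auto
      then show ?thesis by (intro exI[of _ "- n"]) auto
    qed
  qed
  then obtain n where n: "int (fib (J - 3)) \<le> \<bar>n\<bar>" "B \<le> (X + 1) * cmod (u n)" by blast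
  have "(R + 2) * B \<le> (R + 2) * ((X + 1) * cmod (u n))" using n(2) R0 by (intro mult_left_mono) auto
  then show ?thesis using B n(1) by (intro exI[of _ n]) (simp add: mult.assoc)
qed

section \<open>The Green function as a Laplace transform of the evolution\<close>

lemma norm_basis_ell2: "norm (basis_ell2 m) = 1"
proof -
  have "(norm (basis_ell2 m))\<^sup>2 = Re (cinner_ell2 (basis_ell2 m) (basis_ell2 m))"
    by (simp add: power2_norm_eq_inner inner_ell2_def)
  then have "(norm (basis_ell2 m))\<^sup>2 = 1\<^sup>2" by (simp add: cinner_basis_ell2 basis_ell2.rep_eq)
  then show ?thesis by (rule power2_eq_imp_eq) auto
qed

lemma green_function_exists:
  fixes V \<omega> T :: real
  assumes "T > 0" "Im z = 2 / T"
  obtains u :: "int \<Rightarrow> complex" where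
    "\<And>n. u (n + 1) + u (n - 1) + of_real (fib_potential V \<omega> n) * u n - z * u n = (if n = 0 then 1 else 0)"
    "\<And>n. ennreal (2 / T * (cmod (u n))\<^sup>2) \<le> (\<integral>\<^sup>+t\<in>{0..}. ennreal (exp (- 2 * t / T) *
       (cmod (coord (unitary_group (fibonacci_hamiltonian V \<omega>) t (basis_ell2 0)) n))\<^sup>2) \<partial>lborel)"
proof -
  let ?H = "fibonacci_hamiltonian V \<omega>"
  define y where "y n t = coord (unitary_group ?H t (basis_ell2 0)) n" for n t
  have z: "Im z > 0" using assms by simp
  have y1: "cmod (y n t) \<le> 1" for n t
    using cmod_coord_le_norm[of "unitary_group ?H t (basis_ell2 0)" n]
      norm_unitary_group[of ?H t "basis_ell2 0", OF fibonacci_hamiltonian_selfadjoint]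
    by (simp add: y_def norm_basis_ell2)
  define y' where "y' n t = - \<i> * (y (n + 1) t + y (n - 1) t + of_real (fib_potential V \<omega> n) * y n t)" for n t
  have deriv: "(y n has_vector_derivative y' n t) (at t)" for n t
    using coord_unitary_group_has_vector_derivative[of ?H "basis_ell2 0" n t]
    by (simp add: y_def[abs_def] y'_def fibonacci_hamiltonian.rep_eq fib_map.rep_eq)
  have yc: "continuous_on UNIV (y n)" for n
    by (intro continuous_at_imp_continuous_on ballI has_vector_derivative_continuous[OF deriv])
  have y'c: "continuous_on UNIV (y' n)" for n
    unfolding y'_def using yc by (intro continuous_intros)
  have y'1: "cmod (y' n t) \<le> 2 + \<bar>V\<bar>" for n t
  proof -
    have "cmod (y' n t) \<le> cmod (y (n + 1) t) + cmod (y (n - 1) t) + \<bar>fib_potential V \<omega> n\<bar> * cmod (y n t)"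
      unfolding y'_def by (simp add: norm_mult norm_triangle_le norm_triangle_mono norm_triangle_ineq)
    also have "\<dots> \<le> 1 + 1 + \<bar>V\<bar> * 1"
      by (intro add_mono mult_mono y1 abs_fib_potential_le) auto
    finally show ?thesis by simp
  qed
  define U where "U n = (LINT t:{0<..}|lborel. exp (\<i> * z * of_real t) * y n t)" for n
  have int: "set_integrable lborel {0<..} (\<lambda>t. exp (\<i> * z * of_real t) * y n t)" for n
    by (rule set_integrable_exp_neg_bounded[OF z, where B = 1])
      (use y1 yc in \<open>auto simp: norm_mult mult_left_le intro!: continuous_intros\<close>)
  have U': "(LINT t:{0<..}|lborel. exp (\<i> * z * of_real t) * y' n t)
      = - \<i> * (U (n + 1) + U (n - 1) + of_real (fib_potential V \<omega> n) * U n)" for n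
  proof -
    have "(LINT t:{0<..}|lborel. exp (\<i> * z * of_real t) * y' n t) =
      (LINT t:{0<..}|lborel. - \<i> * (exp (\<i> * z * of_real t) * y (n + 1) t + exp (\<i> * z * of_real t) * y (n - 1) t
         + of_real (fib_potential V \<omega> n) * (exp (\<i> * z * of_real t) * y n t)))"
      by (simp add: y'_def algebra_simps)
    also have "\<dots> = - \<i> * (U (n + 1) + U (n - 1) + of_real (fib_potential V \<omega> n) * U n)"
      unfolding U_def
      by (simp only: set_integral_mult_right set_integral_add set_integrable_mult_right int)
    finally show ?thesis .
  qed
  have y0: "y n 0 = (if n = 0 then 1 else 0)" for n
    by (simp add: y_def unitary_group_0 basis_ell2.rep_eq)
  have eq: "\<i> * z * U n - \<i> * (U (n + 1) + U (n - 1) + of_real (fib_potential V \<omega> n) * U n)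
      = - (if n = 0 then 1 else 0)" for n
    using laplace_transform_derivative[of "y n" "y' n", OF y1 y'c y'1 deriv z] U'[of n]
    by (simp add: U_def y0)
  show ?thesis
  \<comment> \<open>The factor \<open>\<i>\<close> turns the transformed evolution equation into the
    resolvent equation and leaves moduli unchanged.\<close>
  proof (rule that[of "\<lambda>n. \<i> * U n"])
    show "\<i> * U (n + 1) + \<i> * U (n - 1) + of_real (fib_potential V \<omega> n) * (\<i> * U n) - z * (\<i> * U n)
        = (if n = 0 then 1 else 0)" for n
      using arg_cong[OF eq[of n], of uminus] by (simp add: algebra_simps)
    show "ennreal (2 / T * (cmod (\<i> * U n))\<^sup>2) \<le> (\<integral>\<^sup>+t\<in>{0..}. ennreal (exp (- 2 * t / T) *
       (cmod (coord (unitary_group ?H t (basis_ell2 0)) n))\<^sup>2) \<partial>lborel)" for n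
      using laplace_transform_bound[of "y n" z, OF yc y1 z] assms(2)
      by (simp add: U_def y_def norm_mult)
  qed
qed

section \<open>Transport exponents\<close>

lemma ennreal_moment_term_le:
  "ennreal (\<bar>real_of_int n\<bar> powr p * (cmod (coord (unitary_group H t \<psi>) n))\<^sup>2) \<le> position_moment H \<psi> p t"
proof -
  let ?f = "\<lambda>n. ennreal (\<bar>real_of_int n\<bar> powr p * (cmod (cinner_ell2 (basis_ell2 n) (unitary_group H t \<psi>)))\<^sup>2)"
  have "infsum ?f {n} \<le> infsum ?f UNIV"
    by (rule infsum_mono_neutral) (auto intro: nonneg_summable_on_complete)
  then show ?thesis by (simp add: position_moment_def cinner_basis_ell2)
qed

text \<open>All sites but one are dropped from the moment, so \<open>n\<close> may be chosen
  separately for each \<open>T\<close>.\<close>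

lemma time_average_moment_ge:
  assumes "T > 0" "B \<ge> 0"
    and "ennreal B \<le> (\<integral>\<^sup>+t\<in>{0..}. ennreal (exp (- 2 * t / T) *
       (cmod (coord (unitary_group H t \<psi>) n))\<^sup>2) \<partial>lborel)"
  shows "ennreal (2 / T * (\<bar>real_of_int n\<bar> powr p * B)) \<le> time_average (position_moment H \<psi> p) T"
proof -
  let ?y = "\<lambda>t. coord (unitary_group H t \<psi>) n"
  let ?N = "\<bar>real_of_int n\<bar> powr p"
  have "continuous_on UNIV ?y"
    by (intro continuous_at_imp_continuous_on ballI
        has_vector_derivative_continuous[OF coord_unitary_group_has_vector_derivative])
  then have [measurable]: "?y \<in> borel_measurable borel" by (rule borel_measurable_continuous_onI)
  have "ennreal (?N * B) = ennreal ?N * ennreal B" using assms by (simp add: ennreal_mult)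
  also have "\<dots> \<le> ennreal ?N * (\<integral>\<^sup>+t\<in>{0..}. ennreal (exp (- 2 * t / T) * (cmod (?y t))\<^sup>2) \<partial>lborel)"
    by (intro mult_left_mono assms(3)) auto
  also have "\<dots> = (\<integral>\<^sup>+t. ennreal ?N * (ennreal (exp (- 2 * t / T) * (cmod (?y t))\<^sup>2) * indicator {0..} t) \<partial>lborel)"
    by (rule nn_integral_cmult[symmetric]) measurable
  also have "\<dots> \<le> (\<integral>\<^sup>+t\<in>{0..}. ennreal (exp (- 2 * t / T)) * position_moment H \<psi> p t \<partial>lborel)"
  proof (rule nn_integral_mono)
    fix t :: real
    have "ennreal ?N * ennreal (exp (- 2 * t / T) * (cmod (?y t))\<^sup>2)
        = ennreal (exp (- 2 * t / T)) * ennreal (?N * (cmod (?y t))\<^sup>2)"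
      by (simp add: ennreal_mult[symmetric] mult_ac)
    also have "\<dots> \<le> ennreal (exp (- 2 * t / T)) * position_moment H \<psi> p t"
      by (intro mult_left_mono ennreal_moment_term_le) auto
    finally show "ennreal ?N * (ennreal (exp (- 2 * t / T) * (cmod (?y t))\<^sup>2) * indicator {0..} t)
        \<le> ennreal (exp (- 2 * t / T)) * position_moment H \<psi> p t * indicator {0..} t"
      by (simp add: mult.assoc[symmetric] mult_right_mono)
  qed
  finally have "ennreal (2 / T) * ennreal (?N * B)
      \<le> ennreal (2 / T) * (\<integral>\<^sup>+t\<in>{0..}. ennreal (exp (- 2 * t / T)) * position_moment H \<psi> p t \<partial>lborel)"
    by (rule mult_left_mono) auto
  moreover have "ennreal (2 / T * (?N * B)) = ennreal (2 / T) * ennreal (?N * B)"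
    using assms by (intro ennreal_mult) auto
  ultimately show ?thesis by (simp only: time_average_def)
qed

lemma ln_le_ln_ennreal:
  assumes "0 < x" "ennreal x \<le> y"
  shows "ereal (ln x) \<le> ln_ennreal y"
proof (cases y)
  case (real r)
  then have "x \<le> r" using assms by simp
  then show ?thesis using assms real by (auto simp: ln_ennreal_def)
qed (auto simp: ln_ennreal_def)

text \<open>The constant \<open>C\<close> contributes \<open>ln C / (p * ln T)\<close>, which tends
  to \<open>0\<close>.\<close>

lemma lower_transport_exponent_ge:
  assumes "p > 0" "C > 0"
    and "\<And>T. T \<ge> T0 \<Longrightarrow> ennreal (C * T powr s) \<le> time_average (position_moment H \<psi> p) T"
  shows "ereal (s / p) \<le> lower_transport_exponent H \<psi> p"
proof -
  have lim: "((\<lambda>T. (ln C + s * ln T) / (p * ln T)) \<longlongrightarrow> s / p) at_top"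
  proof -
    have "((\<lambda>T. ln C / p / ln T + s / p) \<longlongrightarrow> s / p) at_top"
      by (rule tendsto_eq_intros tendsto_divide_0 ln_at_top filterlim_at_top_imp_at_infinity refl | simp)+
    moreover have "\<forall>\<^sub>F T in at_top. ln C / p / ln T + s / p = (ln C + s * ln T) / (p * ln T)"
      using eventually_gt_at_top[of 1] by eventually_elim (use assms in \<open>simp add: field_simps\<close>)
    ultimately show ?thesis by (rule Lim_transform_eventually)
  qed
  have "\<forall>\<^sub>F T in at_top. ereal ((ln C + s * ln T) / (p * ln T)) \<le> growth_rate H \<psi> p T"
    using eventually_gt_at_top[of 1] eventually_ge_at_top[of T0]
  proof eventually_elim
    case (elim T)
    have pos: "p * ln T > 0" using elim assms by simp
    have "ereal (ln (C * T powr s)) \<le> ln_ennreal (time_average (position_moment H \<psi> p) T)"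
      using assms elim by (intro ln_le_ln_ennreal) auto
    then have "ereal (ln (C * T powr s)) / ereal (p * ln T) \<le> growth_rate H \<psi> p T"
      unfolding growth_rate_def using pos by (intro ereal_divide_right_mono) auto
    moreover have "ln (C * T powr s) = ln C + s * ln T"
      using assms elim by (simp add: ln_mult ln_powr)
    moreover have "p \<noteq> 0" "ln T \<noteq> 0" using pos by auto
    ultimately show ?case by simp
  qed
  then have "Liminf at_top (\<lambda>T. ereal ((ln C + s * ln T) / (p * ln T))) \<le> Liminf at_top (growth_rate H \<psi> p)"
    by (rule Liminf_mono)
  moreover have "Liminf at_top (\<lambda>T. ereal ((ln C + s * ln T) / (p * ln T))) = ereal (s / p)"
    using lim by (intro lim_imp_Liminf) auto
  ultimately show ?thesis by (simp add: lower_transport_exponent_def)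
qed

section \<open>Numerical comparison and the final estimate\<close>

lemma golden_power_le_fib:
  fixes g :: real
  assumes "g\<^sup>2 = g + 1" "g \<le> 2"
  shows "g ^ n \<le> real (fib (Suc (Suc n)))"
proof (induction n rule: fib.induct)
  case (3 n)
  have "g ^ Suc (Suc n) = g ^ n * g\<^sup>2" by (simp add: power2_eq_square)
  also have "\<dots> = g ^ Suc n + g ^ n" unfolding assms(1) by (simp add: algebra_simps)
  finally show ?case using 3 by simp
qed (use assms in simp_all)

text \<open>Finiteness of the root set gives \<open>Max\<close> its meaning; a sign change on
  \<open>[1, 3 + V]\<close> supplies a root that is at least \<open>1\<close>.\<close>

lemma a_root_ge_1:
  assumes "V \<ge> 0"
  shows "a_root V \<ge> 1"
proof -
  let ?S = "{x::real. x ^ 3 - (2 + V) * x - 1 = 0}"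
  have "?S = {x. poly [:-1, - (2 + V), 0, 1:] x = 0}"
    by (auto simp: power3_eq_cube algebra_simps)
  also have "finite \<dots>" by (rule poly_roots_finite) simp
  finally have fin: "finite ?S" .
  have "\<exists>x. 1 \<le> x \<and> x \<le> 3 + V \<and> x ^ 3 - (2 + V) * x - 1 = 0"
  proof (rule IVT')
    have "0 \<le> (3 + V) * ((3 + V) * (3 + V) - (2 + V)) - 1"
    proof -
      have "1 \<le> (3 + V) * (3 + V) - (2 + V)" using assms by (simp add: algebra_simps)
      then have "3 * 1 \<le> (3 + V) * ((3 + V) * (3 + V) - (2 + V))"
        using assms by (intro mult_mono) auto
      then show ?thesis by simp
    qed
    then show "0 \<le> (3 + V) ^ 3 - (2 + V) * (3 + V) - 1" by (simp add: power3_eq_cube algebra_simps)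
  qed (use assms in \<open>auto intro!: continuous_intros\<close>)
  then obtain x where "1 \<le> x" "x \<in> ?S" by auto
  then show ?thesis unfolding a_root_def using Max_ge[OF fin] by (meson order_trans)
qed

text \<open>With \<open>g\<close> the golden ratio and \<open>D\<close> the argument of the
  logarithm in \<open>c\<close>, two estimates suffice: \<open>8 + V \<le> g * D\<close> compares
  the leading terms, and \<open>g ^ 2 \<le> D\<close> gives \<open>2 * \<phi> \<le> c\<close>, hence
  \<open>2 * (\<phi> + c) \<le> 3 * c\<close>.\<close>

lemma exponent_comparison:
  fixes V p :: real
  assumes "V > 0" "p > 0"
  defines "\<phi> \<equiv> ln ((sqrt 5 + 1) / 2)"
    and "c \<equiv> ln ((5 + 2 * V) powr (1 / 2) * (3 + V) * a_root V)"
  shows "\<phi> / (\<phi> + c) - 3 * c / (p * (\<phi> + c)) \<le> (p * \<phi> / ln (8 + V) - 2) / p"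
proof -
  define g where "g = (sqrt 5 + 1) / 2"
  define D where "D = (5 + 2 * V) powr (1 / 2) * (3 + V) * a_root V"
  have s5: "11 / 5 < sqrt 5" using real_less_rsqrt[of "11 / 5" 5] by (simp add: power2_eq_square)
  then have g: "8 / 5 < g" by (simp add: g_def)
  have g2: "g\<^sup>2 = g + 1" by (simp add: g_def power2_eq_square field_simps)
  have a: "1 \<le> a_root V" using a_root_ge_1 assms by simp
  have "sqrt 5 \<le> sqrt (5 + 2 * V)" using assms by (intro real_sqrt_le_mono) auto
  then have "11 / 5 \<le> sqrt (5 + 2 * V)" using s5 by linarith
  then have "11 / 5 \<le> (5 + 2 * V) powr (1 / 2)" using assms by (simp add: powr_half_sqrt)
  then have "11 / 5 * (3 + V) * 1 \<le> D"
    unfolding D_def using a assms by (intro mult_mono) auto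
  then have D: "11 / 5 * (3 + V) \<le> D" by simp
  have D0: "D > 0" using D assms by (smt (verit) divide_pos_pos mult_pos_pos)
  have "sqrt 5 \<le> sqrt 9" by (subst real_sqrt_le_iff) simp
  then have "g \<le> 2" by (simp add: g_def)
  then have "g\<^sup>2 \<le> D" unfolding g2 using D assms by simp
  then have "ln (g\<^sup>2) \<le> ln D" using g by (subst ln_le_cancel_iff) (auto simp: D0)
  then have c2: "2 * \<phi> \<le> c" using g by (simp add: \<phi>_def c_def g_def D_def ln_realpow)
  have "8 + V \<le> 8 / 5 * (11 / 5 * (3 + V))" using assms by simp
  also have "\<dots> \<le> g * D" using g D assms by (intro mult_mono) auto
  finally have "ln (8 + V) \<le> ln (g * D)" using assms by (subst ln_le_cancel_iff) (use g D0 in auto)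
  also have "\<dots> = ln g + ln D" using g D0 by (intro ln_mult_pos) auto
  also have "\<dots> = \<phi> + c" by (simp only: \<phi>_def c_def g_def D_def)
  finally have \<rho>: "ln (8 + V) \<le> \<phi> + c" .
  have \<phi>: "\<phi> > 0" using g by (simp add: \<phi>_def g_def)
  have l: "ln (8 + V) > 0" using assms by simp
  have "\<phi> / (\<phi> + c) \<le> \<phi> / ln (8 + V)"
    using \<rho> l \<phi> by (intro divide_left_mono mult_pos_pos) auto
  moreover have "2 / p \<le> 3 * c / (p * (\<phi> + c))"
  proof -
    have "\<phi> + c \<noteq> 0" using c2 \<phi> by simp
    then have "2 / p = 2 * (\<phi> + c) / (p * (\<phi> + c))"
      by (rule nonzero_mult_divide_mult_cancel_right[symmetric])
    also have "\<dots> \<le> 3 * c / (p * (\<phi> + c))"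
      using c2 \<phi> assms(2) by (intro divide_right_mono) auto
    finally show ?thesis .
  qed
  moreover have "(p * \<phi> / ln (8 + V) - 2) / p = \<phi> / ln (8 + V) - 2 / p"
    using assms(2) by (simp add: field_simps)
  ultimately show ?thesis by linarith
qed

lemma time_average_moment_power_bound:
  fixes V \<omega> p :: real
  assumes "V > 0" "p > 0"
  obtains C T0 where "C > 0"
    "\<And>T. T \<ge> T0 \<Longrightarrow> ennreal (C * T powr (p * ln ((sqrt 5 + 1) / 2) / ln (8 + V) - 2))
       \<le> time_average (position_moment (fibonacci_hamiltonian V \<omega>) (basis_ell2 0) p) T"
proof -
  define g \<rho> where "g = (sqrt 5 + 1) / 2" and "\<rho> = 8 + V"
  \<comment> \<open>This is \<open>(R + 2) * (X + 1)\<close> from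
    \<open>two_sided_lower_bound\<close> with \<open>R = 2 * V + 4\<close> and
    \<open>X = 7 + V\<close>.\<close>
  define D where "D = (2 * V + 6) * (8 + V)"
  \<comment> \<open>One factor \<open>2 / T\<close> comes from the time average and one from the
    Laplace bound, hence the \<open>4\<close>. The exponential absorbs the offsets
    \<open>ln 2 / ln \<rho>\<close> and \<open>6\<close> in \<open>L - 6\<close>.\<close>
  define C where "C = 4 / D\<^sup>2 * exp (- (p * ln g * (ln 2 / ln \<rho> + 6)))"
  define T0 where "T0 = 2 * \<rho> ^ 7"
  have \<rho>: "\<rho> > 1" and l: "ln \<rho> > 0" and D: "D > 0" using assms by (simp_all add: \<rho>_def D_def)
  have "sqrt 5 \<le> sqrt 9" "sqrt 1 \<le> sqrt 5" by (subst real_sqrt_le_iff, simp)+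
  then have g: "1 \<le> g" "g \<le> 2" by (simp_all add: g_def)
  have g2: "g\<^sup>2 = g + 1" by (simp add: g_def power2_eq_square field_simps)
  have "C > 0" using D by (simp add: C_def)
  moreover have "ennreal (C * T powr (p * ln g / ln \<rho> - 2))
       \<le> time_average (position_moment (fibonacci_hamiltonian V \<omega>) (basis_ell2 0) p) T" if "T \<ge> T0" for T
  proof -
    have "1 \<le> \<rho> ^ 7" using \<rho> by simp
    then have T: "T \<ge> 2" using that by (simp add: T0_def)
    \<comment> \<open>The floor of \<open>L\<close> is the largest level with
      \<open>\<rho> ^ J * (2 / T) \<le> 1\<close>, and \<open>T0\<close> is chosen to make it at
      least \<open>7\<close>.\<close>
    define L where "L = ln (T / 2) / ln \<rho>"
    define J where "J = nat \<lfloor>L\<rfloor>"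
    have "ln (\<rho> ^ 7) \<le> ln (T / 2)" using that \<rho> T by (subst ln_le_cancel_iff) (auto simp: T0_def)
    then have L7: "L \<ge> 7" using l \<rho> by (simp add: L_def ln_realpow le_divide_eq)
    then have J: "real J \<le> L" "L < real J + 1" "J \<ge> 7" unfolding J_def by linarith+
    have "\<rho> ^ J = exp (real J * ln \<rho>)" using \<rho> by (simp add: exp_of_nat_mult)
    also have "\<dots> \<le> exp (L * ln \<rho>)" using J l by simp
    also have "\<dots> = T / 2" using l T by (simp add: L_def)
    finally have "\<rho> ^ J \<le> T / 2" .
    then have \<delta>: "\<rho> ^ J * (2 / T) \<le> 1" using T by (simp add: field_simps)
    obtain E where E: "\<bar>E\<bar> \<le> 3 + V"
      "\<And>z j. cmod (z - of_real E) \<le> 2 / T \<Longrightarrow> (8 + V) ^ J * (2 / T) \<le> 1 \<Longrightarrow> j \<le> J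
        \<Longrightarrow> cmod (fib_trace (of_real V) z j) \<le> 7 + V"
      using fib_trace_near_spectrum[of V "2 / T" J] assms by auto
    define z where "z = Complex E (2 / T)"
    have "z - of_real E = Complex 0 (2 / T)" by (simp add: z_def complex_eq_iff)
    then have "cmod (z - of_real E) \<le> 2 / T" using T by (simp add: cmod_def)
    then have X: "cmod (fib_trace (of_real V) z j) \<le> 7 + V" if "j \<le> J" for j
      using E(2) \<delta> that by (simp add: \<rho>_def)
    have "0 \<le> 2 / T" "2 / T \<le> 1" using T by simp_all
    moreover have "cmod z \<le> \<bar>E\<bar> + \<bar>2 / T\<bar>" using cmod_le[of z] by (simp only: z_def complex.sel)
    ultimately have "cmod z \<le> 4 + V" using E(1) by linarith
    then have R: "\<bar>V\<bar> + cmod z \<le> 2 * V + 4" using assms by simp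
    obtain u where u: "\<And>n. u (n + 1) + u (n - 1) + of_real (fib_potential V \<omega> n) * u n - z * u n = (if n = 0 then 1 else 0)"
      "\<And>n. ennreal (2 / T * (cmod (u n))\<^sup>2) \<le> (\<integral>\<^sup>+t\<in>{0..}. ennreal (exp (- 2 * t / T) *
       (cmod (coord (unitary_group (fibonacci_hamiltonian V \<omega>) t (basis_ell2 0)) n))\<^sup>2) \<partial>lborel)"
      using green_function_exists[of T z V \<omega>] T by (auto simp: z_def)
    obtain n where n: "int (fib (J - 3)) \<le> \<bar>n\<bar>" "1 \<le> (2 * V + 4 + 2) * (7 + V + 1) * cmod (u n)"
      using two_sided_lower_bound[OF \<open>J \<ge> 7\<close> X u(1) R] by blast
    have "1 / D \<le> cmod (u n)" using n(2) D by (simp add: D_def divide_le_eq mult.commute add.commute)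
    then have un: "1 / D\<^sup>2 \<le> (cmod (u n))\<^sup>2"
      using power_mono[of "1 / D" "cmod (u n)" 2] D by (simp add: power_divide)
    \<comment> \<open>From \<open>J > L - 1\<close> follows \<open>J - 5 > L - 6\<close>; the index
      \<open>J - 5\<close> is two below \<open>J - 3\<close>, as in
      \<open>golden_power_le_fib\<close>.\<close>
    have "exp (ln g * (L - 6)) \<le> exp (ln g * real (J - 5))"
      using g J by (intro iffD2[OF exp_le_cancel_iff] mult_left_mono) auto
    also have "\<dots> = g ^ (J - 5)" using g by (simp add: exp_of_nat_mult mult.commute[of "ln g"])
    also have "\<dots> \<le> real (fib (J - 3))"
      using golden_power_le_fib[OF g2 g(2), of "J - 5"] J(3) by (simp add: numeral_eq_Suc Suc_diff_Suc)
    also have "\<dots> \<le> \<bar>real_of_int n\<bar>" using n(1) by linarith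
    finally have "exp (ln g * (L - 6)) powr p \<le> \<bar>real_of_int n\<bar> powr p"
      using assms by (intro powr_mono2) auto
    then have np: "exp (p * ln g * (L - 6)) \<le> \<bar>real_of_int n\<bar> powr p"
      by (simp add: powr_def mult.assoc)
    have "C * T powr (p * ln g / ln \<rho> - 2) = 4 / (T\<^sup>2 * D\<^sup>2) * exp (p * ln g * (L - 6))"
    proof -
      have T_powr: "T powr (p * ln g / ln \<rho> - 2) = exp (p * ln g * (ln T / ln \<rho>)) / T\<^sup>2"
      proof -
        have "T powr (p * ln g / ln \<rho> - 2) = T powr (p * ln g / ln \<rho>) / T\<^sup>2"
          using T by (simp add: powr_diff)
        then show ?thesis using T by (simp add: powr_def)
      qed
      have exponent: "p * ln g * (L - 6) = - (p * ln g * (ln 2 / ln \<rho> + 6)) + p * ln g * (ln T / ln \<rho>)"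
        using T by (simp add: L_def ln_div diff_divide_distrib algebra_simps)
      show ?thesis unfolding C_def T_powr exponent exp_add by (simp add: mult.commute)
    qed
    also have "\<dots> = 2 / T * (exp (p * ln g * (L - 6)) * (2 / T * (1 / D\<^sup>2)))"
      by (simp add: power2_eq_square)
    also have "\<dots> \<le> 2 / T * (\<bar>real_of_int n\<bar> powr p * (2 / T * (cmod (u n))\<^sup>2))"
      using T np un D by (intro mult_mono) auto
    finally have "ennreal (C * T powr (p * ln g / ln \<rho> - 2))
        \<le> ennreal (2 / T * (\<bar>real_of_int n\<bar> powr p * (2 / T * (cmod (u n))\<^sup>2)))"
      by (rule ennreal_leI)
    also have "\<dots> \<le> time_average (position_moment (fibonacci_hamiltonian V \<omega>) (basis_ell2 0) p) T"
      by (rule time_average_moment_ge[OF _ _ u(2)]) (use T in auto)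
    finally show ?thesis .
  qed
  ultimately show ?thesis using that unfolding g_def \<rho>_def by blast
qed

theorem corollary3:
  fixes V \<omega> p :: real
  assumes "V > 0" and "p > 0"
  shows "let \<phi> = ln ((sqrt 5 + 1) / 2);
             c = ln ((5 + 2 * V) powr (1 / 2) * (3 + V) * a_root V);
             bound = ereal (\<phi> / (\<phi> + c) - 3 * c / (p * (\<phi> + c)))
         in upper_transport_exponent (fibonacci_hamiltonian V \<omega>) (basis_ell2 0) p \<ge> bound \<and>
            lower_transport_exponent (fibonacci_hamiltonian V \<omega>) (basis_ell2 0) p \<ge> bound"
proof -
  let ?H = "fibonacci_hamiltonian V \<omega>"
  obtain C T0 where "C > 0" "\<And>T. T \<ge> T0 \<Longrightarrow> ennreal (C * T powr (p * ln ((sqrt 5 + 1) / 2) / ln (8 + V) - 2))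
       \<le> time_average (position_moment ?H (basis_ell2 0) p) T"
    using time_average_moment_power_bound[OF assms] by blast
  then have "ereal ((p * ln ((sqrt 5 + 1) / 2) / ln (8 + V) - 2) / p) \<le> lower_transport_exponent ?H (basis_ell2 0) p"
    by (rule lower_transport_exponent_ge[OF assms(2)])
  moreover have "lower_transport_exponent ?H (basis_ell2 0) p \<le> upper_transport_exponent ?H (basis_ell2 0) p"
    unfolding lower_transport_exponent_def upper_transport_exponent_def by (rule Liminf_le_Limsup) simp
  ultimately show ?thesis
    using exponent_comparison[OF assms] unfolding Let_def
    by (meson ereal_less_eq(3) order_trans)
qed

end
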